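(* There exists a sequence of total Boolean functions $f_j:\{0,1\}^{N_j}\to\{0,1\}$ with $\mathrm{UC}(f_j)\to\infty$ such that $R(f_j)\geq \mathrm{UC}(f_j)^{2-o(1)}$, i.e. $R(f_j)\geq \mathrm{UC}(f_j)^{2-\epsilon_j}$ for some sequence $\epsilon_j\to0$.
   Context: For $f:\{0,1\}^n\to\{0,1\}$, $R(f)$ is the bounded-error randomized query complexity: the minimum worst-case number of queries to input bits made by a randomized algorithm that outputs $f(x)$ with probability at least $2/3$ on every input $x$. A certificate for an input $x$ is a partial assignment consistent with $x$ such that every input consistent with it has the same $f$-value as $x$. The unambiguous $b$-certificate complexity $\mathrm{UC}_b(f)$ ($b\in\{0,1\}$) is the minimum $w$ such that there is a set of $b$-certificates (partial assignments certifying value $b$), each fixing at most $w$ variables, such that every input $x$ with $f(x)=b$ is consistent with exactly one of them. $\mathrm{UC}(f)=\max\{\mathrm{UC}_0(f),\mathrm{UC}_1(f)\}$. *)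

theory Defs
  imports "HOL-Probability.Probability_Mass_Function"
begin

text \<open>
  The input bits are indexed by a finite set \<open>I\<close>; the cube \<open>{0,1}\<^sup>n\<close> is the case
  \<open>I = {..<n}\<close>. A Boolean function on the cube is represented by a function on all of
  \<open>'i \<Rightarrow> bool\<close>; no definition below depends on its values outside \<open>cube I\<close>.
  For finite \<open>I\<close> both minima taken with \<open>LEAST\<close> are over nonempty sets: the full decision tree
  and the total assignments show that the bound \<open>card I\<close> is always achievable.
\<close>

definition cube :: "'i set \<Rightarrow> ('i \<Rightarrow> bool) set" where
  "cube I = I \<rightarrow>\<^sub>E UNIV"

datatype (queried: 'i) dtree = Leaf bool | Query 'i "'i dtree" "'i dtree"

primrec run :: "'i dtree \<Rightarrow> ('i \<Rightarrow> bool) \<Rightarrow> bool" where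
  "run (Leaf b) x = b"
| "run (Query i t0 t1) x = (if x i then run t1 x else run t0 x)"

primrec cost :: "'i dtree \<Rightarrow> ('i \<Rightarrow> bool) \<Rightarrow> nat" where
  "cost (Leaf b) x = 0"
| "cost (Query i t0 t1) x = Suc (if x i then cost t1 x else cost t0 x)"

text \<open>
  A randomized algorithm is a probability distribution on deterministic decision trees:
  all coins are tossed in advance. Its worst-case number of queries is taken over all inputs
  and all trees in the support.
\<close>

definition computes_bounded_error ::
    "'i set \<Rightarrow> (('i \<Rightarrow> bool) \<Rightarrow> bool) \<Rightarrow> 'i dtree pmf \<Rightarrow> bool" where
  "computes_bounded_error I f p \<longleftrightarrow>
     (\<forall>t\<in>set_pmf p. queried t \<subseteq> I) \<and>
     (\<forall>x\<in>cube I. measure_pmf.prob p {t. run t x = f x} \<ge> 2 / 3)"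

definition randomized_query_complexity :: "'i set \<Rightarrow> (('i \<Rightarrow> bool) \<Rightarrow> bool) \<Rightarrow> nat" where
  "randomized_query_complexity I f =
     (LEAST q. \<exists>p. computes_bounded_error I f p \<and>
                   (\<forall>t\<in>set_pmf p. \<forall>x\<in>cube I. cost t x \<le> q))"

definition consistent :: "('i \<rightharpoonup> bool) \<Rightarrow> ('i \<Rightarrow> bool) \<Rightarrow> bool" where
  "consistent \<rho> x \<longleftrightarrow> (\<forall>i\<in>dom \<rho>. \<rho> i = Some (x i))"

definition certificate ::
    "'i set \<Rightarrow> (('i \<Rightarrow> bool) \<Rightarrow> bool) \<Rightarrow> ('i \<Rightarrow> bool) \<Rightarrow> ('i \<rightharpoonup> bool) \<Rightarrow> bool" where
  "certificate I f x \<rho> \<longleftrightarrow>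
     dom \<rho> \<subseteq> I \<and> consistent \<rho> x \<and> (\<forall>y\<in>cube I. consistent \<rho> y \<longrightarrow> f y = f x)"

text \<open>Every partial assignment on \<open>I\<close> is consistent with some input, hence a certificate for the value
  \<open>b\<close> is just a certificate for some input of value \<open>b\<close>.\<close>

definition value_certificate ::
    "'i set \<Rightarrow> (('i \<Rightarrow> bool) \<Rightarrow> bool) \<Rightarrow> bool \<Rightarrow> ('i \<rightharpoonup> bool) \<Rightarrow> bool" where
  "value_certificate I f b \<rho> \<longleftrightarrow> (\<exists>x\<in>cube I. f x = b \<and> certificate I f x \<rho>)"

definition UC_val :: "bool \<Rightarrow> 'i set \<Rightarrow> (('i \<Rightarrow> bool) \<Rightarrow> bool) \<Rightarrow> nat" where
  "UC_val b I f =
     (LEAST w. \<exists>C. (\<forall>\<rho>\<in>C. value_certificate I f b \<rho> \<and> card (dom \<rho>) \<le> w) \<and>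
                   (\<forall>x\<in>cube I. f x = b \<longrightarrow> (\<exists>!\<rho>. \<rho> \<in> C \<and> consistent \<rho> x)))"

definition UC :: "'i set \<Rightarrow> (('i \<Rightarrow> bool) \<Rightarrow> bool) \<Rightarrow> nat" where
  "UC I f = max (UC_val False I f) (UC_val True I f)"

end

(*
  The separation is witnessed by g_0 = a single variable and g_(k+1) = CS(OR_n o AND_n o g_k), where CS
  is the cheat sheet construction of Aaronson, Ben-David and Kothari, followed by a last AND_n; with n = 2^m
  the final function has randomized complexity about n^(2k+1) and unambiguous certificate
  complexity n^(k+1) up to factors polynomial in m.

  CS(f) takes 2r copies of f, whose values form the address of a cell; it is 1 iff that cell contains
  valid certificates for all the copies. The cell says where to look, so UC_1(CS(f)) is about C(f) even
  if C(f) is far below UC(f), while UC_0(CS(f)) is about UC(f). AND_n and OR_n then multiply the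
  randomized complexity by n^2 but UC only by n.

  Lower bounds use a combinatorial form of hardness: a distribution on pairs (x, y) with f x = 0 and
  f y = 1 such that a shallow decision tree rarely queries a position where x and y differ. Under AND_n
  and OR_n, hide one such pair in a random block. For CS(f), as long as r copies are unresolved, the
  address of the cell is spread over 2^r possibilities.
*)

theory Submission
  imports Defs "HOL-Probability.Product_PMF"
begin

subsection \<open>Decision trees and hard pairs of inputs\<close>

text \<open>Each level gains because certificates of OR_n o AND_n o g for both values are only about
  n times as large as those of g, while hardness grows by n^2. Unambiguity spoils this: the natural
  unambiguous certificate for 1 also refutes all earlier blocks, at a cost of order n^2. The cheat
  sheet turns plain certificate size back into UC_1. UC_0 keeps one extra factor n, which does not
  accumulate: under AND an unambiguous 0-certificate pays UC_0 for one block and UC_1 for the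
  earlier ones.

  Hard pairs compose without error reduction; every composition costs only constant factors in the
  error \<eta> and in the query bound T, and for fixed k a small initial \<eta> pays for them. The
  last AND multiplies hardness by n but at most doubles the bound on UC, since UC_0 already has that
  factor. This spare n absorbs all factors polynomial in m, once m is large for the given k.\<close>

primrec path :: "'i dtree \<Rightarrow> ('i \<Rightarrow> bool) \<Rightarrow> 'i list" where
  "path (Leaf b) x = []"
| "path (Query i t0 t1) x = i # (if x i then path t1 x else path t0 x)"

lemma cost_eq_length_path: "cost t x = length (path t x)"
  by (induction t) auto

lemma path_cong:
  "(\<And>i. i \<in> set (path t x) \<Longrightarrow> x i = y i) \<Longrightarrow> path t y = path t x"
  by (induction t) (auto split: if_splits)

lemma run_cong:
  "(\<And>i. i \<in> set (path t x) \<Longrightarrow> x i = y i) \<Longrightarrow> run t y = run t x"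
  by (induction t) (auto split: if_splits)

definition separates :: "'i dtree \<Rightarrow> ('i \<Rightarrow> bool) \<Rightarrow> ('i \<Rightarrow> bool) \<Rightarrow> bool" where
  "separates t x y \<longleftrightarrow> (\<exists>i\<in>set (path t x). x i \<noteq> y i)"

text \<open>If \<open>t\<close> met no difference on the path of one input, the other input would
  follow the same path.\<close>

lemma separates_sym: "separates t x y \<longleftrightarrow> separates t y x"
  unfolding separates_def by (metis path_cong)

text \<open>\<open>sel\<close> marks the positions that belong to one block and gives their names
  inside it.\<close>

definition plug :: "('j \<rightharpoonup> 'i) \<Rightarrow> ('j \<Rightarrow> bool) \<Rightarrow> ('i \<Rightarrow> bool) \<Rightarrow> 'j \<Rightarrow> bool" where
  "plug sel X x j = (case sel j of None \<Rightarrow> X j | Some k \<Rightarrow> x k)"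

text \<open>The tree on a block that simulates \<^term>\<open>t\<close>, reading the other variables from \<^term>\<open>X\<close>;
  it gives up when it would need more than \<^term>\<open>m\<close> queries to the block.\<close>

primrec project :: "('j \<rightharpoonup> 'i) \<Rightarrow> ('j \<Rightarrow> bool) \<Rightarrow> 'j dtree \<Rightarrow> nat \<Rightarrow> 'i dtree" where
  "project sel X (Leaf b) = (\<lambda>m. Leaf b)"
| "project sel X (Query j t0 t1) = (\<lambda>m.
     case sel j of
       None \<Rightarrow> if X j then project sel X t1 m else project sel X t0 m
     | Some k \<Rightarrow> (case m of 0 \<Rightarrow> Leaf False
         | Suc m' \<Rightarrow> Query k (project sel X t0 m') (project sel X t1 m')))"

text \<open>Queries outside the block are answered from \<open>X\<close> for free, so what remains
  of the real path is its part inside the block, cut after \<open>m\<close> queries.\<close>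

lemma path_project:
  "path (project sel X t m) x = take m (List.map_filter sel (path t (plug sel X x)))"
proof (induction t arbitrary: m)
  case (Query j t0 t1)
  then show ?case
    by (auto simp: plug_def List.map_filter_simps split: option.splits nat.splits)
qed simp

text \<open>The simulation never reads \<open>X\<close> inside the block, so it is independent of
  the pair sampled there.\<close>

lemma project_cong:
  "(\<And>j. sel j = None \<Longrightarrow> X j = X' j) \<Longrightarrow> project sel X t m = project sel X' t m"
  by (induction t arbitrary: m) (auto split: option.splits nat.splits)

lemma set_map_filter_option: "set (List.map_filter sel js) = {k. \<exists>j\<in>set js. sel j = Some k}"
  by (induction js) (auto simp: List.map_filter_simps split: option.splits)

lemma cost_project_le: "cost (project sel X t m) x \<le> m"
  by (simp add: cost_eq_length_path path_project)

lemma separates_projectI: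
  assumes "length (List.map_filter sel (path t (plug sel X x))) \<le> m"
    and "j \<in> set (path t (plug sel X x))" "sel j = Some k" "x k \<noteq> y k"
  shows "separates (project sel X t m) x y"
  using assms unfolding separates_def
  by (auto simp: path_project set_map_filter_option)

lemma length_map_filter_le: "length (List.map_filter sel js) \<le> length js"
  by (induction js) (auto simp: List.map_filter_simps split: option.splits)

section \<open>Bounding probabilities by conditioning\<close>

lemma prob_mono_support:
  assumes "\<And>x. x \<in> set_pmf p \<Longrightarrow> x \<in> A \<Longrightarrow> x \<in> B"
  shows "measure_pmf.prob p A \<le> measure_pmf.prob p B"
  using assms by (intro measure_pmf.finite_measure_mono_AE) (auto simp: AE_measure_pmf_iff)

lemma prob_bind_pmf_le:
  assumes "\<And>x. x \<in> set_pmf p \<Longrightarrow> measure_pmf.prob (q x) A \<le> c" and "c \<ge> 0"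
  shows "measure_pmf.prob (bind_pmf p q) A \<le> c"
proof -
  have "emeasure (bind_pmf p q) A = (\<integral>\<^sup>+x. emeasure (q x) A \<partial>p)"
    by simp
  also have "\<dots> \<le> (\<integral>\<^sup>+x. ennreal c \<partial>p)"
    using assms
    by (intro nn_integral_mono_AE)
       (auto simp: AE_measure_pmf_iff measure_pmf.emeasure_eq_measure intro!: ennreal_leI)
  also have "\<dots> = ennreal c" by simp
  finally show ?thesis
    using assms(2) by (simp add: measure_pmf.emeasure_eq_measure)
qed

lemma prob_pair_pmf_le_fst:
  assumes "\<And>x. x \<in> set_pmf p \<Longrightarrow> measure_pmf.prob q {y. (x, y) \<in> A} \<le> c" and "c \<ge> 0"
  shows "measure_pmf.prob (pair_pmf p q) A \<le> c"
proof -
  have "pair_pmf p q = bind_pmf p (\<lambda>x. map_pmf (Pair x) q)"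
    by (simp add: pair_pmf_def map_pmf_def)
  then show ?thesis
    using assms by (auto intro!: prob_bind_pmf_le simp: vimage_def)
qed

lemma prob_pair_pmf_le_snd:
  assumes "\<And>y. y \<in> set_pmf q \<Longrightarrow> measure_pmf.prob p {x. (x, y) \<in> A} \<le> c" and "c \<ge> 0"
  shows "measure_pmf.prob (pair_pmf p q) A \<le> c"
proof -
  have "pair_pmf p q = bind_pmf q (\<lambda>y. map_pmf (\<lambda>x. (x, y)) p)"
    unfolding pair_pmf_def map_pmf_def by (rule bind_commute_pmf)
  then show ?thesis
    using assms by (auto intro!: prob_bind_pmf_le simp: vimage_def)
qed

text \<open>Conditioning on all other coordinates leaves one sample of \<open>p j\<close>. This is
  how a hard pair planted among independent ones is isolated.\<close>

lemma prob_Pi_pmf_le: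
  assumes "finite S" "j \<in> S" "c \<ge> 0"
    and "\<And>\<omega>. measure_pmf.prob (p j) {w. fun_upd \<omega> j w \<in> A} \<le> c"
  shows "measure_pmf.prob (Pi_pmf S d p) A \<le> c"
proof -
  have S: "S = insert j (S - {j})" using assms(2) by auto
  have "Pi_pmf S d p = map_pmf (\<lambda>(y, f). f(j := y)) (pair_pmf (p j) (Pi_pmf (S - {j}) d p))"
    by (subst S, subst Pi_pmf_insert) (use assms in auto)
  moreover have "measure_pmf.prob (pair_pmf (p j) (Pi_pmf (S - {j}) d p))
      ((\<lambda>(y, f). f(j := y)) -` A) \<le> c"
    using assms(3,4) by (intro prob_pair_pmf_le_snd) (auto simp: vimage_def)
  ultimately show ?thesis by simp
qed

text \<open>On a pair that it does not separate, a tree gives one answer to both inputs and errs on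
  one of them. Hardness thus speaks of queries only; error probabilities enter only in the final
  bound on the randomized complexity.\<close>

definition hard :: "(('i \<Rightarrow> bool) \<Rightarrow> bool) \<Rightarrow> real \<Rightarrow> real \<Rightarrow> bool" where
  "hard f T \<eta> \<longleftrightarrow> (\<exists>p. (\<forall>(x, y)\<in>set_pmf p. \<not> f x \<and> f y) \<and>
     (\<forall>t. (\<forall>x. real (cost t x) \<le> T) \<longrightarrow> measure_pmf.prob p {(x, y). separates t x y} \<le> \<eta>))"

lemma hard_not:
  assumes "hard f T \<eta>"
  shows "hard (\<lambda>x. \<not> f x) T \<eta>"
proof -
  obtain p where p: "\<forall>(x, y)\<in>set_pmf p. \<not> f x \<and> f y"
    and le: "\<And>t. (\<forall>x. real (cost t x) \<le> T) \<Longrightarrow>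
               measure_pmf.prob p {(x, y). separates t x y} \<le> \<eta>"
    using assms unfolding hard_def by blast
  have "(\<lambda>(x, y). (y, x)) -` {(x, y). separates t x y} = {(x, y). separates t x y}"
    for t :: "'a dtree"
    by (auto simp: separates_sym)
  then show ?thesis
    unfolding hard_def using p le
    by (intro exI[of _ "map_pmf (\<lambda>(x, y). (y, x)) p"]) auto
qed

subsection \<open>Composition with AND and OR\<close>

text \<open>This is OR_n o g for \<open>b = True\<close> and AND_n o g for \<open>b = False\<close>:
  in both cases one block of value \<open>b\<close> forces the output \<open>b\<close>, so
  certificates are treated once for both gates.\<close>

definition any_block :: "bool \<Rightarrow> nat \<Rightarrow> (('i \<Rightarrow> bool) \<Rightarrow> bool) \<Rightarrow> (nat \<times> 'i \<Rightarrow> bool) \<Rightarrow> bool" where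
  "any_block b n g x \<longleftrightarrow> ((\<exists>i<n. g (\<lambda>k. x (i, k)) = b) = b)"

lemma any_block_eq_iff: "any_block b n g x = b \<longleftrightarrow> (\<exists>i<n. g (\<lambda>k. x (i, k)) = b)"
  by (auto simp: any_block_def)

lemma any_block_eq_not_iff: "any_block b n g x = (\<not> b) \<longleftrightarrow> (\<forall>i<n. g (\<lambda>k. x (i, k)) = (\<not> b))"
  by (auto simp: any_block_def)

lemma any_block_False: "any_block False n g x \<longleftrightarrow> \<not> any_block True n (\<lambda>x. \<not> g x) x"
  by (auto simp: any_block_def)

definition block :: "nat \<Rightarrow> nat \<times> 'i \<Rightarrow> 'i option" where
  "block i p = (if fst p = i then Some (snd p) else None)"

lemma sum_length_blocks_le: "(\<Sum>i<n. length (List.map_filter (block i) js)) \<le> length js"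
proof (induction js)
  case (Cons a js)
  have "(\<Sum>i<n. length (List.map_filter (block i) (a # js))) =
      (\<Sum>i<n. (if i = fst a then 1 else 0) + length (List.map_filter (block i) js))"
    by (intro sum.cong) (auto simp: List.map_filter_simps block_def)
  also have "\<dots> \<le> 1 + (\<Sum>i<n. length (List.map_filter (block i) js))"
    by (simp add: sum.distrib)
  finally show ?case using Cons by simp
qed (simp add: List.map_filter_simps)

text \<open>Every block holds the 0-input of its own pair; in a random block \<open>j\<close> it is
  replaced by its partner. Either block \<open>j\<close> receives more than \<open>T\<close>
  queries, which by Markov happens with probability at most \<eta>, or the tree simulated on block
  \<open>j\<close> must separate a hard pair within \<open>T\<close> queries, again with probability
  at most \<eta>.\<close>

lemma hard_or:
  assumes "hard g T \<eta>" "T \<ge> 0" "\<eta> \<ge> 0" "n > 0"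
  shows "hard (any_block True n g) (\<eta> * n * T) (2 * \<eta>)"
proof -
  obtain p where p: "\<And>x y. (x, y) \<in> set_pmf p \<Longrightarrow> \<not> g x \<and> g y"
    and le: "\<And>t. (\<forall>x. real (cost t x) \<le> T) \<Longrightarrow>
               measure_pmf.prob p {(x, y). separates t x y} \<le> \<eta>"
    using assms unfolding hard_def by blast
  define d :: "('a \<Rightarrow> bool) \<times> ('a \<Rightarrow> bool)" where "d = undefined"
  define Z :: "(nat \<Rightarrow> ('a \<Rightarrow> bool) \<times> ('a \<Rightarrow> bool)) \<Rightarrow> nat \<times> 'a \<Rightarrow> bool" where
    "Z \<omega> = (\<lambda>(i, k). if i < n then fst (\<omega> i) k else False)" for \<omega>
  define Y where "Y \<omega> j = plug (block j) (Z \<omega>) (snd (\<omega> j))"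
    for \<omega> :: "nat \<Rightarrow> ('a \<Rightarrow> bool) \<times> ('a \<Rightarrow> bool)" and j
  define P where "P = pair_pmf (Pi_pmf {..<n} d (\<lambda>_. p)) (pmf_of_set {..<n})"
  define Q where "Q = map_pmf (\<lambda>(\<omega>, j). (Z \<omega>, Y \<omega> j)) P"
  have ne: "{..<n} \<noteq> {}" using assms by auto
  have setP: "\<omega> i \<in> set_pmf p" if "(\<omega>, j) \<in> set_pmf P" "i < n" for \<omega> i j
    using that by (auto simp: P_def set_Pi_pmf PiE_dflt_def)
  have jP: "j < n" if "(\<omega>, j) \<in> set_pmf P" for \<omega> j
    using that ne by (auto simp: P_def)
  have vals: "\<not> any_block True n g x \<and> any_block True n g y" if xy: "(x, y) \<in> set_pmf Q" for x y
  proof -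
    obtain \<omega> j where w: "(\<omega>, j) \<in> set_pmf P" and x: "x = Z \<omega>" and y: "y = Y \<omega> j"
      using xy by (auto simp: Q_def)
    have gi: "\<not> g (fst (\<omega> i)) \<and> g (snd (\<omega> i))" if "i < n" for i
      using p[of "fst (\<omega> i)" "snd (\<omega> i)"] setP[OF w that] by simp
    have "(\<lambda>k. x (i, k)) = fst (\<omega> i)" if "i < n" for i
      using that by (auto simp: x Z_def)
    moreover have "(\<lambda>k. y (j, k)) = snd (\<omega> j)"
      by (auto simp: y Y_def plug_def block_def)
    ultimately show ?thesis
      using gi jP[OF w] by (auto simp: any_block_def)
  qed
  have main: "measure_pmf.prob Q {(x, y). separates t x y} \<le> 2 * \<eta>"
    if ct: "\<forall>x. real (cost t x) \<le> \<eta> * n * T" for t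
  proof -
    define m where "m = nat \<lfloor>T\<rfloor>"
    have m: "real m \<le> T" "T < real m + 1"
      using assms(2) unfolding m_def by linarith+
    define B1 where "B1 = {(\<omega>, j). length (List.map_filter (block j) (path t (Z \<omega>))) > m}"
    define B2 where "B2 = {(\<omega>, j). j < n \<and>
      separates (project (block j) (Z \<omega>) t m) (fst (\<omega> j)) (snd (\<omega> j))}"
    have plugZ: "plug (block j) (Z \<omega>) (fst (\<omega> j)) = Z \<omega>" if "j < n" for \<omega> j
      using that by (auto simp: plug_def block_def Z_def fun_eq_iff)
    have "measure_pmf.prob Q {(x, y). separates t x y}
        = measure_pmf.prob P {(\<omega>, j). separates t (Z \<omega>) (Y \<omega> j)}"
      unfolding Q_def by (simp add: vimage_def case_prod_unfold)
    also have "\<dots> \<le> measure_pmf.prob P (B1 \<union> B2)"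
    proof (rule prob_mono_support)
      fix w assume w: "w \<in> set_pmf P" "w \<in> {(\<omega>, j). separates t (Z \<omega>) (Y \<omega> j)}"
      obtain \<omega> j where wj: "w = (\<omega>, j)" by force
      have j: "j < n" using jP[of \<omega> j] w(1) by (simp add: wj)
      obtain q where q: "q \<in> set (path t (Z \<omega>))" "Z \<omega> q \<noteq> Y \<omega> j q"
        using w(2) by (auto simp: wj separates_def)
      have "fst q = j" using q(2) by (auto simp: Y_def plug_def block_def split: if_splits)
      then have sq: "block j q = Some (snd q)" by (simp add: block_def)
      have dq: "fst (\<omega> j) (snd q) \<noteq> snd (\<omega> j) (snd q)"
        using q(2) sq j \<open>fst q = j\<close> by (auto simp: Y_def plug_def Z_def split: prod.splits)
      show "w \<in> B1 \<union> B2"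
      proof (cases "length (List.map_filter (block j) (path t (Z \<omega>))) \<le> m")
        case True
        have "separates (project (block j) (Z \<omega>) t m) (fst (\<omega> j)) (snd (\<omega> j))"
          by (rule separates_projectI[of _ _ _ _ _ q "snd q"])
             (use True q sq dq plugZ[OF j] in auto)
        then show ?thesis using j by (simp add: wj B2_def)
      qed (simp add: wj B1_def)
    qed
    also have "\<dots> \<le> measure_pmf.prob P B1 + measure_pmf.prob P B2"
      by (rule measure_Un_le) auto
    also have "measure_pmf.prob P B1 \<le> \<eta>"
      unfolding P_def
    proof (rule prob_pair_pmf_le_fst)
      fix \<omega>
      define q where "q j = length (List.map_filter (block j) (path t (Z \<omega>)))" for j
      \<comment> \<open>The path on \<open>Z \<omega>\<close> does not depend on \<open>j\<close>,
        so a uniform \<open>j\<close> lands in \<open>K\<close> with probability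
        \<open>card K / n\<close>.\<close>
      define K where "K = {j. j < n \<and> q j > m}"
      have "T * real (card K) \<le> (real m + 1) * card K"
        using m by (intro mult_right_mono) auto
      also have "\<dots> = real (\<Sum>j\<in>K. m + 1)" by (simp add: algebra_simps)
      also have "\<dots> \<le> real (\<Sum>j\<in>K. q j)"
        unfolding of_nat_le_iff by (intro sum_mono) (auto simp: K_def)
      also have "\<dots> \<le> real (\<Sum>j<n. q j)"
        unfolding of_nat_le_iff by (intro sum_mono2) (auto simp: K_def)
      also have "\<dots> \<le> real (cost t (Z \<omega>))"
        unfolding q_def cost_eq_length_path of_nat_le_iff by (rule sum_length_blocks_le)
      also have le1: "\<dots> \<le> \<eta> * n * T" using ct by simp
      finally have *: "T * real (card K) \<le> T * (\<eta> * n)" by (simp add: mult_ac)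
      have "real (card K) \<le> \<eta> * n"
      \<comment> \<open>For \<open>T = 0\<close> one cannot divide by \<open>T\<close>, but then the
        tree makes no query and \<open>K\<close> is empty.\<close>
      proof (cases "T = 0")
        case True
        have "real (card K) = real (\<Sum>j\<in>K. 1)" by simp
        also have "\<dots> \<le> real (\<Sum>j\<in>K. q j)"
          unfolding of_nat_le_iff by (intro sum_mono) (auto simp: K_def)
        also have "\<dots> \<le> real (\<Sum>j<n. q j)"
          unfolding of_nat_le_iff by (intro sum_mono2) (auto simp: K_def)
        also have "\<dots> \<le> real (cost t (Z \<omega>))"
          unfolding q_def cost_eq_length_path of_nat_le_iff by (rule sum_length_blocks_le)
        also have "\<dots> \<le> 0" using le1 True by simp
        finally show ?thesis using assms(3) by (smt (verit) mult_nonneg_nonneg of_nat_0_le_iff)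
      next
        case False
        then show ?thesis using * assms(2) by (simp add: mult_le_cancel_left)
      qed
      moreover have "{..<n} \<inter> {y. (\<omega>, y) \<in> B1} = K"
        by (auto simp: B1_def K_def q_def)
      ultimately show "measure_pmf.prob (pmf_of_set {..<n}) {y. (\<omega>, y) \<in> B1} \<le> \<eta>"
        using ne assms(4) by (simp add: measure_pmf_of_set pos_divide_le_eq)
    qed (fact assms)
    also have "measure_pmf.prob P B2 \<le> \<eta>"
      unfolding P_def
    proof (rule prob_pair_pmf_le_snd)
      fix j assume "j \<in> set_pmf (pmf_of_set {..<n})"
      then have j: "j < n" using ne by simp
      show "measure_pmf.prob (Pi_pmf {..<n} d (\<lambda>_. p)) {\<omega>. (\<omega>, j) \<in> B2} \<le> \<eta>"
      proof (rule prob_Pi_pmf_le)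
        fix \<omega>
        \<comment> \<open>With all other blocks fixed, the simulated tree is fixed too, and only the
          pair in block \<open>j\<close> is random.\<close>
        have "project (block j) (Z (fun_upd \<omega> j w)) t m = project (block j) (Z \<omega>) t m" for w
          by (rule project_cong) (auto simp: Z_def block_def split: prod.splits if_splits)
        then have "{w. fun_upd \<omega> j w \<in> {\<omega>. (\<omega>, j) \<in> B2}} =
            {(x, y). separates (project (block j) (Z \<omega>) t m) x y}"
          using j by (auto simp: B2_def)
        moreover have "\<forall>x. real (cost (project (block j) (Z \<omega>) t m) x) \<le> T"
          using m(1) cost_project_le[of "block j" "Z \<omega>" t m]
          by (auto intro: order_trans[OF of_nat_mono])
        ultimately show "measure_pmf.prob p {w. fun_upd \<omega> j w \<in> {\<omega>. (\<omega>, j) \<in> B2}} \<le> \<eta>"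
          using le by simp
      qed (use j assms in auto)
    qed (fact assms)
    finally show ?thesis by simp
  qed
  show ?thesis
    unfolding hard_def using vals main by (intro exI[of _ Q]) auto
qed

lemma hard_any_block:
  assumes "hard g T \<eta>" "T \<ge> 0" "\<eta> \<ge> 0" "n > 0"
  shows "hard (any_block b n g) (\<eta> * n * T) (2 * \<eta>)"
proof (cases b)
  case False
  have "any_block b n g = (\<lambda>x. \<not> any_block True n (\<lambda>x. \<not> g x) x)"
    using False by (simp add: fun_eq_iff any_block_False)
  then show ?thesis
    using hard_not[OF hard_or[OF hard_not[OF assms(1)] assms(2-4)]] by simp
qed (use hard_or assms in auto)

text \<open>Cost at most 1/2 means no query at all. The bound is not 0 because later steps multiply
  it.\<close>

lemma hard_variable: "\<eta> \<ge> 0 \<Longrightarrow> hard (\<lambda>x. x i) (1 / 2) \<eta>"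
  unfolding hard_def
proof (intro exI conjI allI impI)
  fix t :: "'a dtree" assume "\<forall>x. real (cost t x) \<le> 1 / 2" and \<eta>: "\<eta> \<ge> 0"
  then have "real (cost t x) < 1" for x
    by (smt (verit) field_sum_of_halves)
  then have "cost t x = 0" for x by simp
  then have "\<not> separates t x y" for x y
    by (auto simp: separates_def cost_eq_length_path)
  then show "measure_pmf.prob (return_pmf (\<lambda>_. False, \<lambda>_. True))
      {(x, y). separates t x y} \<le> \<eta>"
    using \<eta> by simp
qed auto

subsection \<open>Certificates\<close>

text \<open>The flag \<^term>\<open>u\<close> selects unambiguous certificates: two inputs consistent with a common
  certificate have the same one.\<close>

definition certifies ::
    "bool \<Rightarrow> bool \<Rightarrow> (('i \<Rightarrow> bool) \<Rightarrow> bool) \<Rightarrow> 'i set \<Rightarrow> nat \<Rightarrow> (('i \<Rightarrow> bool) \<Rightarrow> 'i set) \<Rightarrow> bool" where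
  "certifies u b f I w S \<longleftrightarrow> (\<forall>x. f x = b \<longrightarrow> S x \<subseteq> I \<and> card (S x) \<le> w \<and>
     (\<forall>y. (\<forall>i\<in>S x. y i = x i) \<longrightarrow> f y = b \<and> (u \<longrightarrow> S y = S x)))"

definition cert :: "bool \<Rightarrow> bool \<Rightarrow> (('i \<Rightarrow> bool) \<Rightarrow> bool) \<Rightarrow> 'i set \<Rightarrow> nat \<Rightarrow> bool" where
  "cert u b f I w \<longleftrightarrow> (\<exists>S. certifies u b f I w S)"

lemma certifiesD:
  assumes "certifies u b f I w S" "f x = b"
  shows "S x \<subseteq> I" "card (S x) \<le> w"
    "(\<And>i. i \<in> S x \<Longrightarrow> y i = x i) \<Longrightarrow> f y = b"
    "(\<And>i. i \<in> S x \<Longrightarrow> y i = x i) \<Longrightarrow> u \<Longrightarrow> S y = S x"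
  using assms(1)[unfolded certifies_def, rule_format, OF assms(2)] by blast+

lemma certI:
  assumes "\<And>x. f x = b \<Longrightarrow> S x \<subseteq> I"
    "\<And>x. f x = b \<Longrightarrow> card (S x) \<le> w"
    "\<And>x y. f x = b \<Longrightarrow> (\<And>i. i \<in> S x \<Longrightarrow> y i = x i) \<Longrightarrow> f y = b \<and> (u \<longrightarrow> S y = S x)"
  shows "cert u b f I w"
  unfolding cert_def certifies_def
proof (intro exI allI impI)
  fix x assume x: "f x = b"
  show "S x \<subseteq> I \<and> card (S x) \<le> w \<and>
     (\<forall>y. (\<forall>i\<in>S x. y i = x i) \<longrightarrow> f y = b \<and> (u \<longrightarrow> S y = S x))"
  proof (intro conjI allI impI)
    fix y assume y: "\<forall>i\<in>S x. y i = x i"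
    show "f y = b" using assms(3)[OF x, of y] y by blast
    show "S y = S x" if u using assms(3)[OF x, of y] y that by blast
  qed (fact assms(1,2)[OF x])+
qed

lemma cert_mono:
  assumes "cert u b f I w" "w \<le> w'" "u' \<Longrightarrow> u"
  shows "cert u' b f I w'"
proof -
  obtain S where "certifies u b f I w S"
    using assms(1) unfolding cert_def ..
  note S = certifiesD[OF this]
  show ?thesis
  proof (rule certI[where S = S])
    fix x y assume x: "f x = b" and y: "\<And>i. i \<in> S x \<Longrightarrow> y i = x i"
    show "f y = b \<and> (u' \<longrightarrow> S y = S x)"
      using S(3)[OF x y] S(4)[OF x y] assms(3) by blast
  qed (use S(1,2) assms(2) in \<open>auto intro: le_trans\<close>)
qed

text \<open>Certificates for both values lie inside \<open>I\<close>, so the variables in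
  \<open>I\<close> determine the value. Renaming the variables relies on this.\<close>

lemma cert_depends:
  assumes "cert u b f I w" "cert u' (\<not> b) f I w'" "\<And>i. i \<in> I \<Longrightarrow> x i = y i"
  shows "f x = f y"
proof -
  have *: "f y = c" if c: "cert v c f I w" "f x = c" for c v w
  proof -
    obtain S where "certifies v c f I w S"
      using c(1) unfolding cert_def ..
    note S = certifiesD[OF this]
    show ?thesis using S(1)[OF c(2)] assms(3) by (intro S(3)[OF c(2)]) (metis subsetD)
  qed
  show ?thesis by (cases "f x = b") (use *[OF assms(1)] *[OF assms(2)] in simp_all)
qed

lemma card_Sigma_le:
  assumes "finite A" "\<And>i. i \<in> A \<Longrightarrow> card (B i) \<le> w"
  shows "card (Sigma A B) \<le> card A * w"
proof -
  have "card (Sigma A B) = card (\<Union>i\<in>A. Pair i ` B i)"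
    by (intro arg_cong[where f = card]) auto
  also have "\<dots> \<le> (\<Sum>i\<in>A. card (Pair i ` B i))"
    by (rule card_UN_le[OF assms(1)])
  also have "\<dots> \<le> (\<Sum>i\<in>A. w)"
    using assms(2) by (intro sum_mono) (simp add: card_image inj_on_def)
  finally show ?thesis by simp
qed

lemma cert_any_block_all:
  assumes "cert u (\<not> b) g I w"
  shows "cert u (\<not> b) (any_block b n g) ({..<n} \<times> I) (n * w)"
proof -
  obtain S where "certifies u (\<not> b) g I w S"
    using assms unfolding cert_def ..
  note S = certifiesD[OF this]
  define R where "R x = Sigma {..<n} (\<lambda>i. S (\<lambda>k. x (i, k)))" for x :: "nat \<times> 'a \<Rightarrow> bool"
  show ?thesis
  proof (rule certI[where S = R])
    fix x assume "any_block b n g x = (\<not> b)"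
    then have x: "g (\<lambda>k. x (i, k)) = (\<not> b)" if "i < n" for i
      using that by (auto simp: any_block_eq_not_iff)
    show "R x \<subseteq> {..<n} \<times> I" using S(1)[OF x] by (auto simp: R_def)
    show "card (R x) \<le> n * w"
      using card_Sigma_le[of "{..<n}" "\<lambda>i. S (\<lambda>k. x (i, k))" w] S(2)[OF x]
      by (simp add: R_def)
    fix y assume y: "\<And>p. p \<in> R x \<Longrightarrow> y p = x p"
    then have "g (\<lambda>k. y (i, k)) = (\<not> b)" "u \<longrightarrow> S (\<lambda>k. y (i, k)) = S (\<lambda>k. x (i, k))"
      if "i < n" for i
      using S(3)[OF x[OF that], of "\<lambda>k. y (i, k)"] S(4)[OF x[OF that], of "\<lambda>k. y (i, k)"] that
      by (auto simp: R_def)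
    then show "any_block b n g y = (\<not> b) \<and> (u \<longrightarrow> R y = R x)"
      unfolding any_block_eq_not_iff R_def by (auto intro!: Sigma_cong)
  qed
qed

text \<open>One block of value \<open>b\<close> suffices. The result is ambiguous, since a
  consistent input may have an earlier block of value \<open>b\<close>.\<close>

lemma cert_any_block_some:
  assumes "cert False b g I w"
  shows "cert False b (any_block b n g) ({..<n} \<times> I) w"
proof -
  obtain S where "certifies False b g I w S"
    using assms unfolding cert_def ..
  note S = certifiesD[OF this]
  define j where "j x = (LEAST i. i < n \<and> g (\<lambda>k. x (i, k)) = b)" for x
  define R where "R x = {j x} \<times> S (\<lambda>k. x (j x, k))" for x :: "nat \<times> 'a \<Rightarrow> bool"
  show ?thesis
  proof (rule certI[where S = R])
    fix x assume "any_block b n g x = b"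
    then have j: "j x < n" "g (\<lambda>k. x (j x, k)) = b"
      using LeastI_ex[of "\<lambda>i. i < n \<and> g (\<lambda>k. x (i, k)) = b"]
      by (auto simp: any_block_eq_iff j_def)
    show "R x \<subseteq> {..<n} \<times> I" using S(1)[OF j(2)] j(1) by (auto simp: R_def)
    show "card (R x) \<le> w" using S(2)[OF j(2)] by (simp add: R_def card_cartesian_product)
    fix y assume "\<And>p. p \<in> R x \<Longrightarrow> y p = x p"
    then have "g (\<lambda>k. y (j x, k)) = b"
      by (intro S(3)[OF j(2)]) (auto simp: R_def)
    then show "any_block b n g y = b \<and> (False \<longrightarrow> R y = R x)"
      using j(1) by (auto simp: any_block_eq_iff)
  qed
qed

text \<open>The unambiguous certificate locates the first block of value \<^term>\<open>b\<close> and certifies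
  that all earlier blocks have the other value.\<close>

lemma cert_any_block_first:
  assumes "cert True b g I w" and "cert True (\<not> b) g I w'"
  shows "cert True b (any_block b n g) ({..<n} \<times> I) (w + n * w')"
proof -
  obtain S where "certifies True b g I w S"
    using assms(1) unfolding cert_def ..
  note S = certifiesD[OF this]
  define j where "j x = (LEAST i. i < n \<and> g (\<lambda>k. x (i, k)) = b)" for x :: "nat \<times> 'a \<Rightarrow> bool"
  have j: "j x < n \<and> g (\<lambda>k. x (j x, k)) = b \<and> (\<forall>i<j x. g (\<lambda>k. x (i, k)) = (\<not> b))"
    if "any_block b n g x = b" for x
  proof -
    have "j x < n \<and> g (\<lambda>k. x (j x, k)) = b"
      using that LeastI_ex[of "\<lambda>i. i < n \<and> g (\<lambda>k. x (i, k)) = b"]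
      by (auto simp: any_block_eq_iff j_def)
    moreover have "g (\<lambda>k. x (i, k)) = (\<not> b)" if "i < j x" for i
      using not_less_Least[of i "\<lambda>i. i < n \<and> g (\<lambda>k. x (i, k)) = b"] that calculation
      by (auto simp: j_def)
    ultimately show ?thesis by blast
  qed
  have j_eqI: "j y = i" if "i < n" "g (\<lambda>k. y (i, k)) = b" "\<And>l. l < i \<Longrightarrow> g (\<lambda>k. y (l, k)) = (\<not> b)"
    for y i
    unfolding j_def using that by (intro Least_equality) (auto simp: not_le[symmetric])
  obtain S' where "certifies True (\<not> b) g I w' S'"
    using assms(2) unfolding cert_def ..
  note S' = certifiesD[OF this]
  define R1 where "R1 x = Sigma {j x} (\<lambda>i. S (\<lambda>k. x (i, k)))" for x
  define R2 where "R2 x = Sigma {..<j x} (\<lambda>i. S' (\<lambda>k. x (i, k)))" for x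
  show ?thesis
  proof (rule certI[where S = "\<lambda>x. R1 x \<union> R2 x"])
    fix x assume x: "any_block b n g x = b"
    have j1: "j x < n" "g (\<lambda>k. x (j x, k)) = b"
      and j2: "\<And>i. i < j x \<Longrightarrow> g (\<lambda>k. x (i, k)) = (\<not> b)"
      using j[OF x] by auto
    show "R1 x \<union> R2 x \<subseteq> {..<n} \<times> I"
      using S(1)[OF j1(2)] S'(1)[OF j2] j1(1) by (auto simp: R1_def R2_def)
    have "card (R1 x \<union> R2 x) \<le> card (R1 x) + card (R2 x)" by (rule card_Un_le)
    also have "card (R1 x) \<le> 1 * w"
      using card_Sigma_le[of "{j x}" "\<lambda>i. S (\<lambda>k. x (i, k))" w] S(2)[OF j1(2)]
      by (simp add: R1_def)
    also have "card (R2 x) \<le> j x * w'"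
      using card_Sigma_le[of "{..<j x}" "\<lambda>i. S' (\<lambda>k. x (i, k))" w'] S'(2)[OF j2]
      by (simp add: R2_def)
    also have "\<dots> \<le> n * w'" using j1(1) by simp
    finally show "card (R1 x \<union> R2 x) \<le> w + n * w'" by simp
    fix y assume y: "\<And>p. p \<in> R1 x \<union> R2 x \<Longrightarrow> y p = x p"
    have y1: "y (j x, k) = x (j x, k)" if "k \<in> S (\<lambda>k. x (j x, k))" for k
      using y[of "(j x, k)"] that by (simp add: R1_def)
    have y2: "y (i, k) = x (i, k)" if "i < j x" "k \<in> S' (\<lambda>k. x (i, k))" for i k
      using y[of "(i, k)"] that by (simp add: R2_def)
    have g1: "g (\<lambda>k. y (j x, k)) = b" "S (\<lambda>k. y (j x, k)) = S (\<lambda>k. x (j x, k))"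
      by (rule S(3)[OF j1(2) y1], assumption) (rule S(4)[OF j1(2) y1], auto)
    have g2: "g (\<lambda>k. y (i, k)) = (\<not> b)" "S' (\<lambda>k. y (i, k)) = S' (\<lambda>k. x (i, k))"
      if "i < j x" for i
      by (rule S'(3)[OF j2[OF that] y2[OF that]], assumption)
         (rule S'(4)[OF j2[OF that] y2[OF that]], auto)
    have "j y = j x" using j1(1) g1(1) g2(1) by (rule j_eqI)
    then show "any_block b n g y = b \<and> (True \<longrightarrow> R1 y \<union> R2 y = R1 x \<union> R2 x)"
      using g1 g2 j1(1) unfolding any_block_eq_iff R1_def R2_def
      by (auto intro!: arg_cong2[where f = "(\<union>)"] Sigma_cong)
  qed
qed

lemma cert_variable: "cert u b (\<lambda>x. x i) {i} 1"
  by (rule certI[where S = "\<lambda>_. {i}"]) auto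

lemma cert_reindex:
  assumes "cert u b f I w" and "\<And>i. i \<in> I \<Longrightarrow> h' (h i) = i"
  shows "cert u b (\<lambda>z. f (\<lambda>i. z (h i))) (h ` I) w"
proof -
  obtain S where "certifies u b f I w S"
    using assms(1) unfolding cert_def ..
  note S = certifiesD[OF this]
  have inj: "inj_on h I" using assms(2) by (metis inj_on_def)
  show ?thesis
  proof (rule certI[where S = "\<lambda>z. h ` S (\<lambda>i. z (h i))"])
    fix x assume x: "f (\<lambda>i. x (h i)) = b"
    show "h ` S (\<lambda>i. x (h i)) \<subseteq> h ` I" using S(1)[OF x] by auto
    show "card (h ` S (\<lambda>i. x (h i))) \<le> w"
      using S(2)[OF x] inj_on_subset[OF inj S(1)[OF x]] by (simp add: card_image)
    fix y assume "\<And>i. i \<in> h ` S (\<lambda>i. x (h i)) \<Longrightarrow> y i = x i"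
    then show "f (\<lambda>i. y (h i)) = b \<and> (u \<longrightarrow> h ` S (\<lambda>i. y (h i)) = h ` S (\<lambda>i. x (h i)))"
      using S(3)[OF x, of "\<lambda>i. y (h i)"] S(4)[OF x, of "\<lambda>i. y (h i)"] by auto
  qed
qed

subsection \<open>Renaming variables\<close>

lemma path_map_dtree: "path (map_dtree h t) x = map h (path t (\<lambda>j. x (h j)))"
  by (induction t) auto

text \<open>Pairs are transported along \<open>h'\<close> and trees are renamed by
  \<open>h'\<close>. As \<open>h'\<close> inverts \<open>h\<close> on \<open>I\<close> only,
  \<open>f\<close> must not depend on anything else.\<close>

lemma hard_reindex:
  assumes "hard f T \<eta>" and "\<And>i. i \<in> I \<Longrightarrow> h' (h i) = i"
    and dep: "\<And>x y. (\<And>i. i \<in> I \<Longrightarrow> x i = y i) \<Longrightarrow> f x = f y"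
  shows "hard (\<lambda>z. f (\<lambda>i. z (h i))) T \<eta>"
proof -
  obtain p where p: "\<And>x y. (x, y) \<in> set_pmf p \<Longrightarrow> \<not> f x \<and> f y"
    and le: "\<And>t. (\<forall>x. real (cost t x) \<le> T) \<Longrightarrow>
               measure_pmf.prob p {(x, y). separates t x y} \<le> \<eta>"
    using assms(1) unfolding hard_def by blast
  define q where "q = map_pmf (\<lambda>(x, y). (\<lambda>j. x (h' j), \<lambda>j. y (h' j))) p"
  have f: "f (\<lambda>i. x (h' (h i))) = f x" for x
    by (rule dep) (simp add: assms(2))
  have "measure_pmf.prob q {(x, y). separates t x y} \<le> \<eta>"
    if t: "\<forall>x. real (cost t x) \<le> T" for t
  proof -
    have sep: "separates t (\<lambda>j. x (h' j)) (\<lambda>j. y (h' j)) \<longleftrightarrow> separates (map_dtree h' t) x y" for x y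
      by (auto simp: separates_def path_map_dtree)
    have "\<forall>x. real (cost (map_dtree h' t) x) \<le> T"
      using t by (simp add: cost_eq_length_path path_map_dtree)
    from le[OF this] show ?thesis
      by (simp add: q_def vimage_def case_prod_unfold sep)
  qed
  moreover have "\<forall>(x, y)\<in>set_pmf q. \<not> f (\<lambda>i. x (h i)) \<and> f (\<lambda>i. y (h i))"
    using p by (auto simp: q_def f)
  ultimately show ?thesis unfolding hard_def by (intro exI[of _ q]) auto
qed

lemma ex_renaming:
  assumes "finite I"
  obtains h :: "'i \<Rightarrow> nat" and h' where "h ` I = {..<card I}" "\<And>i. i \<in> I \<Longrightarrow> h' (h i) = i"
proof -
  obtain h where "bij_betw h I {0..<card I}"
    using ex_bij_betw_finite_nat[OF assms] by blast
  then show ?thesis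
    using that[of h "the_inv_into I h"]
    by (auto simp: bij_betw_def the_inv_into_f_f lessThan_atLeast0)
qed

subsection \<open>Bounds on UC and on the randomized query complexity\<close>

text \<open>A lower bound on ordinary certificate complexity for the value \<open>b\<close>, and
  hence on the unambiguous one.\<close>

definition needs :: "bool \<Rightarrow> (('i \<Rightarrow> bool) \<Rightarrow> bool) \<Rightarrow> nat \<Rightarrow> bool" where
  "needs b f n \<longleftrightarrow> (\<exists>x. f x = b \<and>
     (\<forall>S. finite S \<longrightarrow> (\<forall>y. (\<forall>i\<in>S. y i = x i) \<longrightarrow> f y = b) \<longrightarrow> n \<le> card S))"

text \<open>With \<open>x\<close> in every block, a certificate must touch each block, because
  \<open>y\<close> could be planted in an untouched one.\<close>

lemma needs_any_block:
  assumes "g x = (\<not> b)" "g y = b"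
  shows "needs (\<not> b) (any_block b n g) n"
proof -
  define X where "X = (\<lambda>(i :: nat, k). x k)"
  have "n \<le> card S"
    if S: "finite S" "\<forall>z. (\<forall>p\<in>S. z p = X p) \<longrightarrow> any_block b n g z = (\<not> b)" for S
  proof -
    have "i \<in> fst ` S" if i: "i < n" for i
    proof (rule ccontr)
      assume ni: "i \<notin> fst ` S"
      define z where "z = (\<lambda>(l, k). if l = i then y k else x k)"
      have "\<forall>p\<in>S. z p = X p" using ni by (force simp: z_def X_def)
      with S(2) have "any_block b n g z = (\<not> b)" by blast
      moreover have "(\<lambda>k. z (i, k)) = y" by (simp add: z_def)
      ultimately show False using i assms(2) by (auto simp: any_block_eq_not_iff)
    qed
    then have "card {..<n} \<le> card (fst ` S)" using S(1) by (intro card_mono) auto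
    also have "\<dots> \<le> card S" by (rule card_image_le[OF S(1)])
    finally show ?thesis by simp
  qed
  moreover have "any_block b n g X = (\<not> b)"
    using assms(1) by (simp add: any_block_eq_not_iff X_def)
  ultimately show ?thesis unfolding needs_def by blast
qed

lemma needs_reindex:
  assumes "needs b f n" and "\<And>i. i \<in> I \<Longrightarrow> h' (h i) = i"
    and dep: "\<And>x y. (\<And>i. i \<in> I \<Longrightarrow> x i = y i) \<Longrightarrow> f x = f y"
  shows "needs b (\<lambda>z. f (\<lambda>i. z (h i))) n"
proof -
  obtain x where x: "f x = b"
    and le: "\<And>S. finite S \<Longrightarrow> (\<forall>y. (\<forall>i\<in>S. y i = x i) \<longrightarrow> f y = b) \<Longrightarrow> n \<le> card S"
    using assms(1) unfolding needs_def by blast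
  have f: "f (\<lambda>i. y (h' (h i))) = f y" for y
    by (rule dep) (simp add: assms(2))
  have "n \<le> card S"
    if S: "finite S" "\<forall>y. (\<forall>i\<in>S. y i = x (h' i)) \<longrightarrow> f (\<lambda>i. y (h i)) = b" for S
  proof -
    have "f y = b" if y: "\<forall>i\<in>h' ` S. y i = x i" for y
      using S(2)[rule_format, of "\<lambda>i. y (h' i)"] y by (simp add: f)
    then have "n \<le> card (h' ` S)" using S(1) by (intro le) auto
    also have "\<dots> \<le> card S" by (rule card_image_le[OF S(1)])
    finally show ?thesis .
  qed
  then show ?thesis
    unfolding needs_def by (intro exI[of _ "\<lambda>j. x (h' j)"]) (simp add: f x)
qed

definition unambiguous_cover where
  "unambiguous_cover b I f w C \<longleftrightarrow>
     (\<forall>\<rho>\<in>C. value_certificate I f b \<rho> \<and> card (dom \<rho>) \<le> w) \<and>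
     (\<forall>x\<in>cube I. f x = b \<longrightarrow> (\<exists>!\<rho>. \<rho> \<in> C \<and> consistent \<rho> x))"

lemma UC_val_eq: "UC_val b I f = (LEAST w. \<exists>C. unambiguous_cover b I f w C)"
  by (simp add: UC_val_def unambiguous_cover_def)

lemma unambiguous_cover_exists:
  assumes "cert True b f I w"
  shows "\<exists>C. unambiguous_cover b I f w C"
proof -
  obtain S where "certifies True b f I w S"
    using assms unfolding cert_def ..
  note S = certifiesD[OF this]
  define \<rho> where "\<rho> x = (\<lambda>i. if i \<in> S x then Some (x i) else None)" for x
  have dom: "dom (\<rho> x) = S x" for x by (auto simp: \<rho>_def dom_def)
  have cons: "consistent (\<rho> x) y \<longleftrightarrow> (\<forall>i\<in>S x. y i = x i)" for x y
    by (auto simp: consistent_def dom) (auto simp: \<rho>_def)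
  have 1: "value_certificate I f b (\<rho> x) \<and> card (dom (\<rho> x)) \<le> w" if x: "f x = b" for x
  proof
    \<comment> \<open>Inputs in the cube are fixed outside \<open>I\<close>; since
      \<open>S x\<close> lies inside \<open>I\<close>, the restriction stays consistent with the
      certificate.\<close>
    let ?x = "restrict x I"
    have agree: "?x i = x i" if "i \<in> S x" for i using S(1)[OF x] that by auto
    have "f ?x = b" by (rule S(3)[OF x agree])
    moreover have "f y = b" if "consistent (\<rho> x) y" for y
      by (rule S(3)[OF x]) (use that in \<open>simp add: cons\<close>)
    ultimately show "value_certificate I f b (\<rho> x)"
      unfolding value_certificate_def certificate_def
      using S(1)[OF x] agree by (intro bexI[of _ ?x]) (auto simp: dom cons cube_def)
    show "card (dom (\<rho> x)) \<le> w" using S(2)[OF x] by (simp add: dom)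
  qed
  have 2: "\<rho> z = \<rho> x" if z: "f z = b" "consistent (\<rho> z) x" for x z
  proof -
    have a: "x i = z i" if "i \<in> S z" for i using z(2) that by (simp add: cons)
    have "S x = S z" by (rule S(4)[OF z(1) a]) auto
    then show ?thesis using a by (auto simp: \<rho>_def)
  qed
  have "unambiguous_cover b I f w (\<rho> ` {x. f x = b})"
    unfolding unambiguous_cover_def
  proof (intro conjI ballI impI)
    fix x assume "f x = b"
    then show "\<exists>!r. r \<in> \<rho> ` {x. f x = b} \<and> consistent r x"
      using 2 by (intro ex1I[of _ "\<rho> x"]) (auto simp: cons)
  qed (use 1 in blast)+
  then show ?thesis ..
qed

lemma UC_val_le: "cert True b f I w \<Longrightarrow> UC_val b I f \<le> w"
  unfolding UC_val_eq by (rule Least_le) (rule unambiguous_cover_exists)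

text \<open>The hypothesis \<open>cert\<close> provides a cover, so the minimum is attained; its
  member consistent with the input from \<open>needs\<close> is a certificate and has at least
  \<open>n\<close> positions.\<close>

lemma UC_val_ge:
  assumes "cert True b f I w" "finite I" "needs b f n"
    and dep: "\<And>x y. (\<And>i. i \<in> I \<Longrightarrow> x i = y i) \<Longrightarrow> f x = f y"
  shows "n \<le> UC_val b I f"
proof -
  obtain C where C: "unambiguous_cover b I f (UC_val b I f) C"
    unfolding UC_val_eq
    using LeastI_ex[of "\<lambda>w. \<exists>C. unambiguous_cover b I f w C"] unambiguous_cover_exists[OF assms(1)]
    by blast
  obtain x where x: "f x = b"
    and le: "\<And>S. finite S \<Longrightarrow> (\<forall>y. (\<forall>i\<in>S. y i = x i) \<longrightarrow> f y = b) \<Longrightarrow> n \<le> card S"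
    using assms(3) unfolding needs_def by blast
  have f: "f (restrict y I) = f y" for y by (rule dep) simp
  have cube: "restrict y I \<in> cube I" for y :: "'a \<Rightarrow> bool" by (simp add: cube_def)
  obtain \<rho> where \<rho>: "\<rho> \<in> C" "consistent \<rho> (restrict x I)"
  proof -
    have "f (restrict x I) = b" using f x by simp
    then have "\<exists>!\<rho>. \<rho> \<in> C \<and> consistent \<rho> (restrict x I)"
      using C cube unfolding unambiguous_cover_def by simp
    then show ?thesis using that by (elim ex1E conjE)
  qed
  then have "value_certificate I f b \<rho>" and card: "card (dom \<rho>) \<le> UC_val b I f"
    using C unfolding unambiguous_cover_def by auto
  then have dom: "dom \<rho> \<subseteq> I" and val: "\<And>y. y \<in> cube I \<Longrightarrow> consistent \<rho> y \<Longrightarrow> f y = b"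
    unfolding value_certificate_def certificate_def by auto
  have "f y = b" if y: "\<forall>i\<in>dom \<rho>. y i = x i" for y
  proof -
    have "consistent \<rho> (restrict y I)"
      using \<rho>(2) y dom unfolding consistent_def by (auto simp: subset_iff)
    then show ?thesis using val[OF cube] f[of y] by simp
  qed
  then have "n \<le> card (dom \<rho>)"
    using finite_subset[OF dom assms(2)] by (intro le) auto
  with card show ?thesis by simp
qed

section \<open>From hard pairs to randomized query complexity\<close>

lemma set_path_subset_queried: "set (path t x) \<subseteq> queried t"
  by (induction t) auto

lemma ex_dtree:
  assumes "finite I" and "\<And>x y. (\<And>i. i \<in> I \<Longrightarrow> x i = y i) \<Longrightarrow> f x = f y"
  shows "\<exists>t. queried t \<subseteq> I \<and> (\<forall>x. run t x = f x)"
  using assms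
proof (induction I arbitrary: f rule: finite_induct)
  case empty
  have "run (Leaf (f (\<lambda>_. False))) x = f x" for x by (simp, rule empty) simp
  moreover have "queried (Leaf (f (\<lambda>_. False))) \<subseteq> {}" by simp
  ultimately show ?case by blast
next
  case (insert i I)
  have "\<exists>t. queried t \<subseteq> I \<and> (\<forall>x. run t x = f (fun_upd x i b))" for b
  proof (rule insert.IH)
    fix x y :: "'a \<Rightarrow> bool" assume "\<And>j. j \<in> I \<Longrightarrow> x j = y j"
    then show "f (fun_upd x i b) = f (fun_upd y i b)"
      by (intro insert.prems) (auto simp: fun_upd_apply)
  qed
  then obtain t where t: "\<And>b. queried (t b) \<subseteq> I \<and> (\<forall>x. run (t b) x = f (fun_upd x i b))"
    using choice[of "\<lambda>b t. queried t \<subseteq> I \<and> (\<forall>x. run t x = f (fun_upd x i b))"] by blast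
  have "run (Query i (t False) (t True)) x = f x" for x
    by (cases "x i") (simp_all add: t fun_upd_idem)
  moreover have "queried (Query i (t False) (t True)) \<subseteq> insert i I" using t by auto
  ultimately show ?case by blast
qed

text \<open>Ensures that the minimum defining the randomized query complexity is attained.\<close>

lemma ex_randomized_algorithm:
  assumes "finite I" and "\<And>x y. (\<And>i. i \<in> I \<Longrightarrow> x i = y i) \<Longrightarrow> f x = f y"
  shows "\<exists>q p. computes_bounded_error I f p \<and> (\<forall>t\<in>set_pmf p. \<forall>x\<in>cube I. cost t x \<le> q)"
proof -
  have "\<exists>t. queried t \<subseteq> I \<and> (\<forall>x. run t x = f x)" by (rule ex_dtree[OF assms])
  then obtain t where t: "queried t \<subseteq> I" "\<forall>x. run t x = f x" by (elim exE conjE)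
  have "cost t x \<le> size t" for t :: "'a dtree" and x
    by (induction t) (simp_all split: if_splits)
  moreover have "computes_bounded_error I f (return_pmf t)"
    using t by (simp add: computes_bounded_error_def)
  ultimately show ?thesis
    by (intro exI[of _ "size t"] exI[of _ "return_pmf t"]) simp
qed

text \<open>A tree that does not separate \<open>x\<close> from \<open>y\<close> errs on one of
  them, so an algorithm fails to separate with probability at most 1/3 + 1/3. By averaging over the
  pairs it separates with probability at most \<eta>, and the two cannot add up to 1 if \<eta> is
  below 1/3.\<close>

lemma randomized_query_complexity_ge:
  assumes "finite I" and dep: "\<And>x y. (\<And>i. i \<in> I \<Longrightarrow> x i = y i) \<Longrightarrow> f x = f y"
    and hard: "hard f T \<eta>" "0 \<le> \<eta>" "\<eta> < 1 / 3"
  shows "T \<le> randomized_query_complexity I f"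
proof (rule ccontr)
  assume less: "\<not> T \<le> randomized_query_complexity I f"
  have "\<exists>p. computes_bounded_error I f p \<and>
      (\<forall>t\<in>set_pmf p. \<forall>x\<in>cube I. cost t x \<le> randomized_query_complexity I f)"
    unfolding randomized_query_complexity_def
    by (rule LeastI_ex[OF ex_randomized_algorithm[OF assms(1,2)]])
  then obtain p where p: "computes_bounded_error I f p"
    and q: "\<And>t x. t \<in> set_pmf p \<Longrightarrow> x \<in> cube I \<Longrightarrow> cost t x \<le> randomized_query_complexity I f"
    by blast
  obtain m where m: "\<And>x y. (x, y) \<in> set_pmf m \<Longrightarrow> \<not> f x \<and> f y"
    and le: "\<And>t. (\<forall>x. real (cost t x) \<le> T) \<Longrightarrow>
               measure_pmf.prob m {(x, y). separates t x y} \<le> \<eta>"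
    using hard(1) unfolding hard_def by blast
  have f: "f (restrict y I) = f y" for y by (rule dep) simp
  have cube: "restrict y I \<in> cube I" for y :: "'a \<Rightarrow> bool" by (simp add: cube_def)
  have qI: "queried t \<subseteq> I" if "t \<in> set_pmf p" for t
    using p that by (auto simp: computes_bounded_error_def)
  have pathI: "x i = restrict x I i" if "t \<in> set_pmf p" "i \<in> set (path t x)" for t x i
    using qI[OF that(1)] set_path_subset_queried[of t x] that(2) by auto
  \<comment> \<open>Hardness asks for the cost bound on all inputs, the complexity gives it on the
    cube; trees that query only \<open>I\<close> do not see the difference.\<close>
  have cost: "real (cost t x) \<le> T" if t: "t \<in> set_pmf p" for t x
  proof -
    have "cost t x = cost t (restrict x I)"
      unfolding cost_eq_length_path by (subst path_cong[OF pathI[OF t]]) simp_all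
    also have "real \<dots> \<le> randomized_query_complexity I f" using q[OF t cube] by simp
    finally show ?thesis using less by simp
  qed
  have run: "run t (restrict x I) = run t x" if t: "t \<in> set_pmf p" for t x
    by (rule run_cong[OF pathI[OF t]])
  have err: "measure_pmf.prob p {t. run t x \<noteq> f x} \<le> 1 / 3" for x
  proof -
    have "measure_pmf.prob p {t. run t x = f x}
        = measure_pmf.prob p {t. run t (restrict x I) = f (restrict x I)}"
      by (intro antisym prob_mono_support) (simp_all add: f run)
    also have "\<dots> \<ge> 2 / 3" using p cube by (simp add: computes_bounded_error_def)
    finally have "measure_pmf.prob p {t. run t x = f x} \<ge> 2 / 3" .
    moreover have "{t. run t x \<noteq> f x} = UNIV - {t. run t x = f x}" by auto
    ultimately show ?thesis
      using measure_pmf.prob_compl[of "{t. run t x = f x}" p] by simp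
  qed
  define E where "E = {(t, x, y). separates t x (y :: 'a \<Rightarrow> bool)}"
  have "measure_pmf.prob (pair_pmf p m) E \<le> \<eta>"
  proof (rule prob_pair_pmf_le_fst)
    fix t assume "t \<in> set_pmf p"
    then show "measure_pmf.prob m {xy. (t, xy) \<in> E} \<le> \<eta>"
      using le[of t] cost by (simp add: E_def)
  qed (use hard in auto)
  moreover have "measure_pmf.prob (pair_pmf p m) (- E) \<le> 2 / 3"
  proof (rule prob_pair_pmf_le_snd)
    fix xy assume xy: "xy \<in> set_pmf m"
    obtain x y where [simp]: "xy = (x, y)" by force
    have "measure_pmf.prob p {t. (t, xy) \<in> - E}
        \<le> measure_pmf.prob p ({t. run t x \<noteq> f x} \<union> {t. run t y \<noteq> f y})"
    proof (rule prob_mono_support)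
      fix t assume "t \<in> {t. (t, xy) \<in> - E}"
      then have "run t y = run t x"
        by (intro run_cong) (auto simp: E_def separates_def)
      then show "t \<in> {t. run t x \<noteq> f x} \<union> {t. run t y \<noteq> f y}"
        using m[of x y] xy by auto
    qed
    also have "\<dots> \<le> measure_pmf.prob p {t. run t x \<noteq> f x} + measure_pmf.prob p {t. run t y \<noteq> f y}"
      by (rule measure_Un_le) auto
    also have "\<dots> \<le> 2 / 3" using err[of x] err[of y] by simp
    finally show "measure_pmf.prob p {t. (t, xy) \<in> - E} \<le> 2 / 3" .
  qed simp
  moreover have "measure_pmf.prob (pair_pmf p m) (- E) = 1 - measure_pmf.prob (pair_pmf p m) E"
    using measure_pmf.prob_compl[of E "pair_pmf p m"] by (simp add: Compl_eq_Diff_UNIV)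
  ultimately show False using hard(3) by simp
qed

subsection \<open>Guessing the address of a cell\<close>

text \<open>Markov's inequality for the random number \<open>card (R x)\<close>, whose expectation
  is at most \<open>card U * c\<close>.\<close>

lemma prob_card_gt_le:
  fixes p :: "'a pmf" and R :: "'a \<Rightarrow> 'b set"
  assumes "finite U" "\<And>x. R x \<subseteq> U" "\<And>i. i \<in> U \<Longrightarrow> measure_pmf.prob p {x. i \<in> R x} \<le> c"
  shows "real r * measure_pmf.prob p {x. r < card (R x)} \<le> real (card U) * c"
proof -
  let ?E = "measure_pmf.expectation p"
  have int: "integrable p (\<lambda>x. indicator A x :: real)" for A
    by (intro measure_pmf.integrable_const_bound[where B = 1]) (auto simp: indicator_def)
  have "real r * measure_pmf.prob p {x. r < card (R x)}
      = ?E (\<lambda>x. real r * indicator {x. r < card (R x)} x)"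
    by simp
  also have "\<dots> \<le> ?E (\<lambda>x. \<Sum>i\<in>U. indicator {x. i \<in> R x} x)"
  proof (rule integral_mono)
    fix x
    have "(\<Sum>i\<in>U. indicator {x. i \<in> R x} x) = (\<Sum>i\<in>U. if i \<in> R x then 1 else 0 :: real)"
      by (intro sum.cong) (auto simp: indicator_def)
    also have "\<dots> = real (card (U \<inter> {i. i \<in> R x}))"
      using assms(1) by (simp flip: sum.inter_restrict)
    also have "U \<inter> {i. i \<in> R x} = R x" using assms(2)[of x] by auto
    finally show "real r * indicator {x. r < card (R x)} x
        \<le> (\<Sum>i\<in>U. indicator {x. i \<in> R x} x)"
      by (simp add: indicator_def)
  qed (intro integrable_mult_right Bochner_Integration.integrable_sum int)+
  also have "\<dots> = (\<Sum>i\<in>U. measure_pmf.prob p {x. i \<in> R x})"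
    using int by (subst Bochner_Integration.integral_sum) simp_all
  also have "\<dots> \<le> (\<Sum>i\<in>U. c :: real)" by (intro sum_mono assms(3))
  finally show ?thesis by simp
qed

definition revealed :: "('j \<rightharpoonup> 'b) \<Rightarrow> 'b set \<Rightarrow> 'j list \<Rightarrow> 'b set" where
  "revealed d U js = {i\<in>U. \<exists>j\<in>set js. d j = Some i}"

text \<open>An input \<^term>\<open>X z\<close> depends on an unknown set \<^term>\<open>z\<close>; querying \<^term>\<open>j\<close> reveals whether
  \<^term>\<open>i \<in> z\<close> if \<^term>\<open>d j = Some i\<close>. As the path branches only when a bit is revealed, a cell
  queried after \<^term>\<open>s\<close> bits are revealed has the address \<^term>\<open>z\<close> with probability
  \<^term>\<open>2 ^ s / 2 ^ card U\<close>; the factor \<^term>\<open>(1 / 2) ^ s\<close> cancels this growth.\<close>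

lemma sum_hit_weight_le:
  fixes X :: "'b set \<Rightarrow> 'j \<Rightarrow> bool" and d :: "'j \<rightharpoonup> 'b" and a :: "'j \<rightharpoonup> 'b set"
  assumes U: "finite U"
    and X: "\<And>j z z'. (\<And>i. d j = Some i \<Longrightarrow> i \<in> z \<longleftrightarrow> i \<in> z') \<Longrightarrow> X z j = X z' j"
    and da: "\<And>j i. d j = Some i \<Longrightarrow> a j = None"
  shows "\<zeta> \<subseteq> U \<Longrightarrow> K \<subseteq> U \<Longrightarrow> (\<And>z. z \<subseteq> U \<Longrightarrow> z \<inter> K = \<zeta> \<inter> K \<Longrightarrow> cost t (X z) \<le> D) \<Longrightarrow>
    (\<Sum>z | z \<subseteq> U \<and> z \<inter> K = \<zeta> \<inter> K. if \<exists>j\<in>set (path t (X z)). a j = Some z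
       then (1 / 2 :: real) ^ card (K \<union> revealed d U (path t (X z))) else 0)
    \<le> real D * (1 / 2) ^ card K"
proof (induction t arbitrary: K \<zeta> D)
  case (Leaf b)
  then show ?case by simp
next
  case (Query j t0 t1)
  define W where "W t K z = (if \<exists>j\<in>set (path t (X z)). a j = Some z
       then (1 / 2 :: real) ^ card (K \<union> revealed d U (path t (X z))) else 0)" for t K z
  \<comment> \<open>\<open>K\<close> collects the indices revealed so far;
    \<open>Z \<zeta> K\<close> are the unknown sets still possible.\<close>
  define Z where "Z \<zeta> K = {z. z \<subseteq> U \<and> z \<inter> K = \<zeta> \<inter> K}" for \<zeta> K
  have finZ: "finite (Z \<zeta> K)" for \<zeta> K using U by (simp add: Z_def)
  define sub where "sub \<zeta> = (if X \<zeta> j then t1 else t0)" for \<zeta>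
  have IH: "(\<Sum>z\<in>Z \<zeta> K. W (sub \<xi>) K z) \<le> real D * (1 / 2) ^ card K"
    if "\<zeta> \<subseteq> U" "K \<subseteq> U" "\<And>z. z \<in> Z \<zeta> K \<Longrightarrow> cost (sub \<xi>) (X z) \<le> D" for \<zeta> K D \<xi>
  proof (cases "X \<xi> j")
    case True
    then show ?thesis
      using Query.IH(2)[of \<zeta> K D] that by (simp add: W_def Z_def sub_def)
  next
    case False
    then show ?thesis
      using Query.IH(1)[of \<zeta> K D] that by (simp add: W_def Z_def sub_def)
  qed
  have path_sub: "path (Query j t0 t1) (X z) = j # path (sub \<xi>) (X z)" if "X z j = X \<xi> j" for z \<xi>
    using that by (simp add: sub_def)
  have cost: "cost (sub \<xi>) (X z) \<le> D - 1" if "X z j = X \<xi> j" "z \<in> Z \<zeta> K" for z \<xi>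
    using Query.prems(3)[of z] that by (auto simp: Z_def sub_def split: if_splits)
  have D: "D \<ge> 1"
    using Query.prems(3)[of \<zeta>] Query.prems(1) by simp
  have goal: "(\<Sum>z\<in>Z \<zeta> K. W (Query j t0 t1) K z) \<le> real D * (1 / 2) ^ card K"
  proof (cases "\<exists>i. d j = Some i \<and> i \<in> U - K")
    case True
    \<comment> \<open>A new bit splits the candidates into two halves. The weight bound of each half
      has one more factor 1/2, so together they give back the bound for \<open>K\<close>.\<close>
    then obtain i where i: "d j = Some i" "i \<in> U" "i \<notin> K" by blast
    have fK: "finite K" using Query.prems(2) U by (rule finite_subset)
    have half: "(\<Sum>z\<in>Z \<xi> (insert i K). W (Query j t0 t1) K z)
        \<le> real (D - 1) * (1 / 2) ^ Suc (card K)"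
      if \<xi>: "\<xi> \<subseteq> U" "\<xi> \<inter> K = \<zeta> \<inter> K" for \<xi>
    proof -
      have eq: "X z j = X \<xi> j" if "z \<in> Z \<xi> (insert i K)" for z
        using that i(1) by (intro X) (auto simp: Z_def)
      have sub: "Z \<xi> (insert i K) \<subseteq> Z \<zeta> K" using \<xi>(2) by (auto simp: Z_def)
      have "W (Query j t0 t1) K z = W (sub \<xi>) (insert i K) z" if z: "z \<in> Z \<xi> (insert i K)" for z
      proof -
        have "K \<union> revealed d U (j # js) = insert i K \<union> revealed d U js" for js
          using i by (auto simp: revealed_def)
        then show ?thesis
          unfolding W_def path_sub[OF eq[OF z]] using da[OF i(1)] by simp
      qed
      then have "(\<Sum>z\<in>Z \<xi> (insert i K). W (Query j t0 t1) K z)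
          = (\<Sum>z\<in>Z \<xi> (insert i K). W (sub \<xi>) (insert i K) z)"
        by (rule sum.cong[OF refl])
      also have "\<dots> \<le> real (D - 1) * (1 / 2) ^ card (insert i K)"
        using \<xi>(1) Query.prems(2) i(2) cost[OF eq] sub by (intro IH) auto
      finally show ?thesis using i(3) fK by simp
    qed
    have split: "Z \<zeta> K = Z (insert i \<zeta>) (insert i K) \<union> Z (\<zeta> - {i}) (insert i K)"
      using i by (auto simp: Z_def)
    have disj: "Z (insert i \<zeta>) (insert i K) \<inter> Z (\<zeta> - {i}) (insert i K) = {}"
      by (auto simp: Z_def)
    have "(\<Sum>z\<in>Z \<zeta> K. W (Query j t0 t1) K z)
        = (\<Sum>z\<in>Z (insert i \<zeta>) (insert i K). W (Query j t0 t1) K z)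
        + (\<Sum>z\<in>Z (\<zeta> - {i}) (insert i K). W (Query j t0 t1) K z)"
      unfolding split by (rule sum.union_disjoint[OF finZ finZ disj])
    also have "\<dots> \<le> real (D - 1) * (1 / 2) ^ Suc (card K) + real (D - 1) * (1 / 2) ^ Suc (card K)"
      using Query.prems(1) i by (intro add_mono half) auto
    also have "\<dots> = real (D - 1) * (1 / 2) ^ card K" by simp
    also have "\<dots> \<le> real D * (1 / 2) ^ card K" by (intro mult_right_mono) auto
    finally show ?thesis .
  next
    case False
    \<comment> \<open>Nothing new is revealed, so all candidates take the same branch, and the
      queried cell has the address of at most one of them. This query adds at most one weight
      \<open>(1 / 2) ^ card K\<close>.\<close>
    have eq: "X z j = X \<zeta> j" if "z \<in> Z \<zeta> K" for z
      using that False Query.prems(1) by (intro X) (auto simp: Z_def)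
    have "W (Query j t0 t1) K z
        \<le> (if a j = Some z then (1 / 2) ^ card K else 0) + W (sub \<zeta>) K z" if z: "z \<in> Z \<zeta> K" for z
    proof -
      have rev: "K \<union> revealed d U (j # js) = K \<union> revealed d U js" for js
        using False by (auto simp: revealed_def)
      have "(1 / 2 :: real) ^ card (K \<union> revealed d U js) \<le> (1 / 2) ^ card K" for js
        using finite_subset[OF Query.prems(2) U] U
        by (intro power_decreasing card_mono) (auto simp: revealed_def)
      then show ?thesis
        unfolding W_def path_sub[OF eq[OF z]] rev by simp
    qed
    then have "(\<Sum>z\<in>Z \<zeta> K. W (Query j t0 t1) K z)
        \<le> (\<Sum>z\<in>Z \<zeta> K. (if a j = Some z then (1 / 2) ^ card K else 0) + W (sub \<zeta>) K z)"
      by (rule sum_mono)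
    also have "\<dots> = (\<Sum>z\<in>Z \<zeta> K. if a j = Some z then (1 / 2) ^ card K else 0)
        + (\<Sum>z\<in>Z \<zeta> K. W (sub \<zeta>) K z)"
      by (rule sum.distrib)
    also have "(\<Sum>z\<in>Z \<zeta> K. if a j = Some z then (1 / 2 :: real) ^ card K else 0) \<le> (1 / 2) ^ card K"
      using finZ by (cases "a j") (auto simp: sum.delta)
    also have "(\<Sum>z\<in>Z \<zeta> K. W (sub \<zeta>) K z) \<le> real (D - 1) * (1 / 2) ^ card K"
      using Query.prems(1,2) cost[OF eq] by (intro IH) auto
    finally show ?thesis using D by (simp add: of_nat_diff algebra_simps)
  qed
  then show ?case by (simp add: W_def Z_def)
qed

subsection \<open>Cheat sheets\<close>

text \<open>A cell stores only positions; the values are read from the copies themselves.\<close>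

definition certifying :: "(('i \<Rightarrow> bool) \<Rightarrow> bool) \<Rightarrow> ('i \<Rightarrow> bool) \<Rightarrow> 'i set \<Rightarrow> bool" where
  "certifying f x S \<longleftrightarrow> (\<forall>y. (\<forall>k\<in>S. y k = x k) \<longrightarrow> f y = f x)"

lemma certifying_cong:
  assumes "f x = f y" "\<And>k. k \<in> S \<Longrightarrow> y k = x k"
  shows "certifying f y S \<longleftrightarrow> certifying f x S"
  using assms by (simp add: certifying_def)

text \<open>Such a set is built in \<open>w\<close> rounds, each of which inserts one of
  \<open>card I\<close> elements or nothing.\<close>

lemma card_subsets_le:
  assumes "finite I"
  shows "finite {S. S \<subseteq> I \<and> card S \<le> w} \<and> card {S. S \<subseteq> I \<and> card S \<le> w} \<le> (card I + 1) ^ w"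
proof (induction w)
  case 0
  have "{S. S \<subseteq> I \<and> card S \<le> 0} = {{}}"
    using assms by (auto dest: finite_subset)
  then show ?case by simp
next
  case (Suc w)
  let ?A = "\<lambda>w. {S. S \<subseteq> I \<and> card S \<le> w}"
  let ?f = "\<lambda>(S, q). case q of None \<Rightarrow> S | Some i \<Rightarrow> insert i S"
  let ?B = "?A w \<times> insert None (Some ` I)"
  have "S \<in> ?f ` ?B" if S: "S \<in> ?A (Suc w)" for S
  proof (cases "card S \<le> w")
    case True
    then show ?thesis using S by (intro image_eqI[of _ _ "(S, None)"]) auto
  next
    case False
    then have "card S = Suc w" using S by auto
    then obtain i S' where i: "S = insert i S'" "i \<notin> S'" "card S' = w"
      by (auto simp: card_Suc_eq)
    then show ?thesis using S by (intro image_eqI[of _ _ "(S', Some i)"]) auto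
  qed
  then have sub: "?A (Suc w) \<subseteq> ?f ` ?B" by blast
  have fin: "finite ?B" using Suc.IH assms by simp
  have "card (?A (Suc w)) \<le> card (?f ` ?B)" using fin sub by (intro card_mono) auto
  also have "\<dots> \<le> card ?B" by (rule card_image_le[OF fin])
  also have "\<dots> = card (?A w) * (card I + 1)"
    using assms by (simp add: card_cartesian_product card_insert_if card_image)
  also have "\<dots> \<le> (card I + 1) ^ w * (card I + 1)" using Suc.IH by (intro mult_right_mono) auto
  finally show ?case using finite_subset[OF sub] fin by (simp add: mult_ac)
qed

text \<open>A cell is a set of bit positions below \<^term>\<open>L\<close>. It encodes one set of variables of size at
  most \<^term>\<open>w\<close> for each of the \<^term>\<open>c\<close> copies, or it is invalid; the empty cell is invalid.\<close>

locale cell_code =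
  fixes I :: "'i set" and c w L :: nat and dec :: "nat set \<Rightarrow> (nat \<Rightarrow> 'i set) option"
  assumes dec_empty: "dec {} = None"
    and dec_subset: "dec B = Some \<sigma> \<Longrightarrow> i < c \<Longrightarrow> \<sigma> i \<subseteq> I"
    and dec_card: "dec B = Some \<sigma> \<Longrightarrow> i < c \<Longrightarrow> card (\<sigma> i) \<le> w"
    and dec_surj: "(\<And>i. i < c \<Longrightarrow> \<sigma> i \<subseteq> I \<and> card (\<sigma> i) \<le> w) \<Longrightarrow>
      \<exists>B\<subseteq>{..<L}. \<exists>\<tau>. dec B = Some \<tau> \<and> (\<forall>i<c. \<tau> i = \<sigma> i)"

lemma ex_cell_code:
  fixes I :: "'i set"
  assumes "finite I" "((card I + 1) ^ w) ^ c < 2 ^ L"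
  shows "\<exists>dec. cell_code I c w L dec"
proof -
  let ?A = "{S. S \<subseteq> I \<and> card S \<le> w}"
  define T where "T = PiE {..<c} (\<lambda>_. ?A)"
  \<comment> \<open>The empty cell is kept out of the code words so that it can be invalid; the
    strict inequality in the assumption leaves room for this.\<close>
  define P where "P = Pow {..<L} - {{}}"
  have "finite T" unfolding T_def using card_subsets_le[OF assms(1)] by (intro finite_PiE) auto
  have "card T = card ?A ^ c" unfolding T_def by (simp add: card_PiE)
  also have "\<dots> \<le> ((card I + 1) ^ w) ^ c"
    using card_subsets_le[OF assms(1)] by (intro power_mono) auto
  also have "\<dots> \<le> card P" using assms(2) by (simp add: P_def card_Pow)
  finally obtain enc where enc: "enc ` T \<subseteq> P" "inj_on enc T"
    using card_le_inj[of T P] \<open>finite T\<close> by (auto simp: P_def)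
  define dec where "dec B = (if B \<in> enc ` T then Some (inv_into T enc B) else None)" for B
  have decD: "\<sigma> i \<in> ?A" if "dec B = Some \<sigma>" "i < c" for B \<sigma> i
  proof -
    have "\<sigma> \<in> T" using that(1) by (auto simp: dec_def inv_into_into split: if_splits)
    then show ?thesis using that(2) unfolding T_def by (blast dest: PiE_mem)
  qed
  have "cell_code I c w L dec"
  proof
    show "dec {} = None" using enc(1) by (auto simp: dec_def P_def)
    show "\<sigma> i \<subseteq> I" "card (\<sigma> i) \<le> w" if "dec B = Some \<sigma>" "i < c" for B \<sigma> i
      using decD[OF that] by auto
    show "\<exists>B\<subseteq>{..<L}. \<exists>\<tau>. dec B = Some \<tau> \<and> (\<forall>i<c. \<tau> i = \<sigma> i)"
      if "\<And>i. i < c \<Longrightarrow> \<sigma> i \<subseteq> I \<and> card (\<sigma> i) \<le> w" for \<sigma>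
    proof -
      let ?\<tau> = "restrict \<sigma> {..<c}"
      have "?\<tau> \<in> T" unfolding T_def using that by (simp add: restrict_PiE_iff)
      then have "enc ?\<tau> \<subseteq> {..<L}" "dec (enc ?\<tau>) = Some ?\<tau>"
        using enc by (auto simp: dec_def P_def)
      then show ?thesis by (intro exI[of _ "enc ?\<tau>"] conjI exI[of _ ?\<tau>]) auto
    qed
  qed
  then show ?thesis by blast
qed

context cell_code
begin

text \<open>In the input, \<open>Inl (i, k)\<close> is variable \<open>k\<close> of copy
  \<open>i\<close> and \<open>Inr (z, q)\<close> is bit \<open>q\<close> of the cell with address
  \<open>z\<close>. Addresses are subsets of \<open>{..<c}\<close> in place of bit strings.\<close>

definition address ::
    "(('i \<Rightarrow> bool) \<Rightarrow> bool) \<Rightarrow> (nat \<times> 'i + nat set \<times> nat \<Rightarrow> bool) \<Rightarrow> nat set" where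
  "address f x = {i. i < c \<and> f (\<lambda>k. x (Inl (i, k)))}"

definition cell :: "(nat \<times> 'i + nat set \<times> nat \<Rightarrow> bool) \<Rightarrow> nat set \<Rightarrow> nat set" where
  "cell x z = {q. q < L \<and> x (Inr (z, q))}"

definition cheat_sheet ::
    "(('i \<Rightarrow> bool) \<Rightarrow> bool) \<Rightarrow> (nat \<times> 'i + nat set \<times> nat \<Rightarrow> bool) \<Rightarrow> bool" where
  "cheat_sheet f x \<longleftrightarrow> (case dec (cell x (address f x)) of None \<Rightarrow> False
     | Some \<sigma> \<Rightarrow> \<forall>i<c. certifying f (\<lambda>k. x (Inl (i, k))) (\<sigma> i))"

definition variables :: "(nat \<times> 'i + nat set \<times> nat) set" where
  "variables = Inl ` ({..<c} \<times> I) \<union> Inr ` (Pow {..<c} \<times> {..<L})"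

definition sheet ::
    "(('i \<Rightarrow> bool) \<Rightarrow> bool) \<Rightarrow> (nat \<times> 'i + nat set \<times> nat \<Rightarrow> bool)
      \<Rightarrow> (nat \<times> 'i + nat set \<times> nat) set" where
  "sheet f x = Inr ` ({address f x} \<times> {..<L}) \<union>
     (case dec (cell x (address f x)) of None \<Rightarrow> {} | Some \<sigma> \<Rightarrow> Inl ` Sigma {..<c} \<sigma>)"

lemma finite_variables: "finite I \<Longrightarrow> finite variables"
  by (simp add: variables_def)

lemma card_variables_le:
  assumes "finite I"
  shows "card variables \<le> c * card I + 2 ^ c * L"
proof -
  have "card variables \<le> card (Inl ` ({..<c} \<times> I) :: (nat \<times> 'i + nat set \<times> nat) set)
      + card (Inr ` (Pow {..<c} \<times> {..<L}) :: (nat \<times> 'i + nat set \<times> nat) set)"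
    unfolding variables_def by (rule card_Un_le)
  also have "\<dots> = c * card I + 2 ^ c * L"
    by (simp add: card_image card_cartesian_product card_Pow)
  finally show ?thesis .
qed

lemma sheet_subset: "sheet f x \<subseteq> variables"
proof -
  have "address f x \<subseteq> {..<c}" by (auto simp: address_def)
  moreover have "Inl ` Sigma {..<c} \<sigma> \<subseteq> variables" if "dec B = Some \<sigma>" for B \<sigma>
    using dec_subset[OF that] unfolding variables_def by blast
  ultimately show ?thesis
    unfolding sheet_def by (auto simp: variables_def split: option.splits)
qed

lemma card_sheet_le: "card (sheet f x) \<le> L + c * w"
proof -
  have "card (Inl ` Sigma {..<c} \<sigma> :: (nat \<times> 'i + nat set \<times> nat) set) \<le> c * w"
    if "dec B = Some \<sigma>" for B \<sigma>
    using card_Sigma_le[of "{..<c}" \<sigma> w] dec_card[OF that] by (simp add: card_image)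
  moreover have "card (Inr ` ({address f x} \<times> {..<L}) :: (nat \<times> 'i + nat set \<times> nat) set) = L"
    by (simp add: card_image card_cartesian_product)
  ultimately show ?thesis
    unfolding sheet_def
    by (intro order_trans[OF card_Un_le] add_mono) (auto split: option.splits)
qed

lemma cheat_sheet_cong:
  assumes addr: "address f y = address f x"
    and agree: "\<And>q. q \<in> sheet f x \<Longrightarrow> y q = x q"
  shows "cheat_sheet f y = cheat_sheet f x" "sheet f y = sheet f x"
proof -
  have "y (Inr (address f x, q)) = x (Inr (address f x, q))" if "q < L" for q
    using that by (intro agree) (auto simp: sheet_def)
  then have cell: "cell y (address f y) = cell x (address f x)"
    by (auto simp: cell_def addr)
  then show "sheet f y = sheet f x" by (simp add: sheet_def addr)
  have "certifying f (\<lambda>k. y (Inl (i, k))) (\<sigma> i) \<longleftrightarrow> certifying f (\<lambda>k. x (Inl (i, k))) (\<sigma> i)"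
    if "dec (cell x (address f x)) = Some \<sigma>" "i < c" for \<sigma> i
  proof (rule certifying_cong)
    show "f (\<lambda>k. x (Inl (i, k))) = f (\<lambda>k. y (Inl (i, k)))"
      using addr that(2) by (auto simp: address_def set_eq_iff)
    show "y (Inl (i, k)) = x (Inl (i, k))" if "k \<in> \<sigma> i" for k
      using that \<open>dec _ = _\<close> \<open>i < c\<close> by (intro agree) (auto simp: sheet_def)
  qed
  then show "cheat_sheet f y = cheat_sheet f x"
    unfolding cheat_sheet_def cell by (auto split: option.splits)
qed

text \<open>The cell itself says where the certificates of the copies are, so reading it along with
  these positions is an unambiguous certificate.\<close>

lemma cert_cheat_sheet_True: "cert True True (cheat_sheet f) variables (L + c * w)"
proof (rule certI[where S = "sheet f"])
  fix x y assume x: "cheat_sheet f x = True"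
    and agree: "\<And>q. q \<in> sheet f x \<Longrightarrow> y q = x q"
  obtain \<sigma> where \<sigma>: "dec (cell x (address f x)) = Some \<sigma>"
    and val: "\<And>i. i < c \<Longrightarrow> certifying f (\<lambda>k. x (Inl (i, k))) (\<sigma> i)"
  proof (cases "dec (cell x (address f x))")
    case (Some \<sigma>)
    then show ?thesis using x that[of \<sigma>] by (simp add: cheat_sheet_def)
  qed (use x in \<open>simp add: cheat_sheet_def\<close>)
  have "f (\<lambda>k. y (Inl (i, k))) = f (\<lambda>k. x (Inl (i, k)))" if "i < c" for i
  proof -
    have "\<forall>k\<in>\<sigma> i. y (Inl (i, k)) = x (Inl (i, k))"
    proof
      fix k assume "k \<in> \<sigma> i"
      then show "y (Inl (i, k)) = x (Inl (i, k))"
        using \<sigma> that by (intro agree) (auto simp: sheet_def)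
    qed
    then show ?thesis by (rule val[OF that, unfolded certifying_def, THEN spec, THEN mp])
  qed
  then have "address f y = address f x" by (auto simp: address_def)
  from cheat_sheet_cong[OF this agree] x
  show "cheat_sheet f y = True \<and> (True \<longrightarrow> sheet f y = sheet f x)" by simp
qed (rule sheet_subset card_sheet_le)+

text \<open>An input of value 0 may have a useless cell, so the address has to be certified copy by
  copy, which adds \<open>c * v\<close>. The flag \<open>u\<close> gives both the unambiguous and
  the plain bound.\<close>

lemma cert_cheat_sheet:
  assumes "cert u True f I v" "cert u False f I v"
  shows "cert u b (cheat_sheet f) variables (L + c * w + c * v)"
proof -
  obtain S1 where "certifies u True f I v S1" using assms(1) unfolding cert_def ..
  note S1 = certifiesD[OF this]
  obtain S0 where "certifies u False f I v S0" using assms(2) unfolding cert_def ..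
  note S0 = certifiesD[OF this]
  define U where "U x = (if f x then S1 x else S0 x)" for x
  have U_sub: "U x \<subseteq> I" and U_card: "card (U x) \<le> v" for x
    using S1(1,2)[of x] S0(1,2)[of x] by (auto simp: U_def)
  have U_agree: "f y = f x \<and> (u \<longrightarrow> U y = U x)" if a: "\<And>i. i \<in> U x \<Longrightarrow> y i = x i" for x y
  proof (cases "f x")
    case True
    then have a': "\<And>i. i \<in> S1 x \<Longrightarrow> y i = x i" using a by (simp add: U_def)
    have "f y = True" by (rule S1(3)[of x]) (use True a' in simp_all)
    moreover have "S1 y = S1 x" if u by (rule S1(4)[of x]) (use True a' that in simp_all)
    ultimately show ?thesis using True by (simp add: U_def)
  next
    case False
    then have a': "\<And>i. i \<in> S0 x \<Longrightarrow> y i = x i" using a by (simp add: U_def)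
    have "f y = False" by (rule S0(3)[of x]) (use False a' in simp_all)
    moreover have "S0 y = S0 x" if u by (rule S0(4)[of x]) (use False a' that in simp_all)
    ultimately show ?thesis using False by (simp add: U_def)
  qed
  define R :: "(nat \<times> 'i + nat set \<times> nat \<Rightarrow> bool) \<Rightarrow> (nat \<times> 'i + nat set \<times> nat) set"
    where "R x = Inl ` Sigma {..<c} (\<lambda>i. U (\<lambda>k. x (Inl (i, k))))" for x
  show ?thesis
  proof (rule certI[where S = "\<lambda>x. sheet f x \<union> R x"])
    fix x assume x: "cheat_sheet f x = b"
    have "R x \<subseteq> variables"
      using U_sub by (force simp: R_def variables_def)
    then show "sheet f x \<union> R x \<subseteq> variables" using sheet_subset by simp
    have "card (R x) \<le> c * v"
      using card_Sigma_le[of "{..<c}" "\<lambda>i. U (\<lambda>k. x (Inl (i, k)))" v] U_card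
      by (simp add: R_def card_image)
    then show "card (sheet f x \<union> R x) \<le> L + c * w + c * v"
      by (intro order_trans[OF card_Un_le] add_mono card_sheet_le)
    fix y assume agree: "\<And>q. q \<in> sheet f x \<union> R x \<Longrightarrow> y q = x q"
    have i: "f (\<lambda>k. y (Inl (i, k))) = f (\<lambda>k. x (Inl (i, k))) \<and>
        (u \<longrightarrow> U (\<lambda>k. y (Inl (i, k))) = U (\<lambda>k. x (Inl (i, k))))" if "i < c" for i
      by (rule U_agree, rule agree) (use that in \<open>auto simp: R_def\<close>)
    then have addr: "address f y = address f x" by (auto simp: address_def)
    have "R y = R x" if u
      unfolding R_def using i that by (intro arg_cong[where f = "image Inl"] Sigma_cong) auto
    moreover have "cheat_sheet f y = cheat_sheet f x" "sheet f y = sheet f x"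
      by (rule cheat_sheet_cong[OF addr], rule agree, simp)+
    ultimately show "cheat_sheet f y = b \<and> (u \<longrightarrow> sheet f y \<union> R y = sheet f x \<union> R x)"
      using x by simp
  qed
qed

text \<open>The 0-input of the hard pair: \<open>z\<close> is the hidden address and all cells are
  empty, hence invalid. Its partner arises by filling the addressed cell, so the two inputs differ
  only there.\<close>

definition copies ::
    "(nat \<Rightarrow> ('i \<Rightarrow> bool) \<times> ('i \<Rightarrow> bool)) \<Rightarrow> nat set \<Rightarrow> nat \<times> 'i + nat set \<times> nat \<Rightarrow> bool" where
  "copies \<omega> z q = (case q of
     Inl (i, k) \<Rightarrow> i < c \<and> (if i \<in> z then snd (\<omega> i) k else fst (\<omega> i) k)
   | Inr _ \<Rightarrow> False)"

definition fill ::
    "(('i \<Rightarrow> bool) \<Rightarrow> bool) \<Rightarrow> nat set \<Rightarrow> (nat \<times> 'i + nat set \<times> nat \<Rightarrow> bool)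
      \<Rightarrow> nat \<times> 'i + nat set \<times> nat \<Rightarrow> bool" where
  "fill f B x q = (case q of
     Inl _ \<Rightarrow> x q
   | Inr (z, b) \<Rightarrow> if z = address f x then b \<in> B else x q)"

definition copy_of :: "nat \<Rightarrow> nat \<times> 'i + nat set \<times> nat \<Rightarrow> 'i option" where
  "copy_of i q = (case q of Inl (l, k) \<Rightarrow> if l = i then Some k else None | Inr _ \<Rightarrow> None)"

text \<open>Only a query at such a position tells whether copy \<open>i\<close> holds the 0-input or
  the 1-input of its pair.\<close>

definition differing ::
    "(nat \<Rightarrow> ('i \<Rightarrow> bool) \<times> ('i \<Rightarrow> bool)) \<Rightarrow> nat \<times> 'i + nat set \<times> nat \<Rightarrow> nat option" where
  "differing \<omega> q = (case q of
     Inl (i, k) \<Rightarrow> if fst (\<omega> i) k \<noteq> snd (\<omega> i) k then Some i else None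
   | Inr _ \<Rightarrow> None)"

definition cell_address :: "nat \<times> 'i + nat set \<times> nat \<Rightarrow> nat set option" where
  "cell_address q = (case q of Inl _ \<Rightarrow> None | Inr (z, _) \<Rightarrow> Some z)"

lemma cheat_sheet_copies: "\<not> cheat_sheet f (copies \<omega> z)"
proof -
  have "cell (copies \<omega> z) u = {}" for u by (simp add: cell_def copies_def)
  then show ?thesis by (simp add: cheat_sheet_def dec_empty)
qed

text \<open>Plain certificates of all copies fit into one cell, and writing them there leaves the
  copies and hence the address unchanged.\<close>

lemma ex_cheat_sheet_fill:
  assumes "cert False True f I w" "cert False False f I w"
  shows "\<exists>B. cheat_sheet f (fill f B x)"
proof -
  obtain S1 where "certifies False True f I w S1" using assms(1) unfolding cert_def ..
  note S1 = certifiesD[OF this]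
  obtain S0 where "certifies False False f I w S0" using assms(2) unfolding cert_def ..
  note S0 = certifiesD[OF this]
  have *: "\<exists>S\<subseteq>I. card S \<le> w \<and> certifying f x S" for x
  proof (cases "f x")
    case True
    then have "certifying f x (S1 x)"
      unfolding certifying_def using S1(3)[of x] by blast
    then show ?thesis using S1(1,2)[of x] True by blast
  next
    case False
    then have "certifying f x (S0 x)"
      unfolding certifying_def using S0(3)[of x] by blast
    then show ?thesis using S0(1,2)[of x] False by blast
  qed
  define \<sigma> where "\<sigma> i = (SOME S. S \<subseteq> I \<and> card S \<le> w \<and> certifying f (\<lambda>k. x (Inl (i, k))) S)" for i
  have \<sigma>: "\<sigma> i \<subseteq> I \<and> card (\<sigma> i) \<le> w \<and> certifying f (\<lambda>k. x (Inl (i, k))) (\<sigma> i)" for i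
    unfolding \<sigma>_def by (rule someI_ex) (rule *)
  obtain B \<tau> where B: "B \<subseteq> {..<L}" "dec B = Some \<tau>" "\<And>i. i < c \<Longrightarrow> \<tau> i = \<sigma> i"
    using dec_surj[of \<sigma>] \<sigma> by blast
  have Inl: "fill f B x (Inl p) = x (Inl p)" for p by (simp add: fill_def)
  then have addr: "address f (fill f B x) = address f x" by (simp add: address_def)
  have "cell (fill f B x) (address f x) = B"
    using B(1) by (auto simp: cell_def fill_def)
  then have "cheat_sheet f (fill f B x)"
    using B(2,3) \<sigma> by (simp add: cheat_sheet_def addr Inl)
  then show ?thesis by blast
qed

text \<open>The weights of the hit sets add up to at most \<open>T\<close>, and a set with at most
  \<open>r\<close> revealed bits weighs at least \<open>(1 / 2) ^ r\<close>. So there are at most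
  \<open>T * 2 ^ r\<close> such sets, which is at most \<eta> times the \<open>2 ^ c\<close>
  possible ones as \<open>c = 2 * r\<close>.\<close>

lemma prob_hit_le:
  assumes c: "c = 2 * r" and cost: "\<And>x. real (cost t x) \<le> T" and T: "T \<le> \<eta> * 2 ^ r" "T \<ge> 0"
  shows "measure_pmf.prob (pmf_of_set (Pow {..<c}))
    {z. (\<exists>q\<in>set (path t (copies \<omega> z)). cell_address q = Some z) \<and>
        card (revealed (differing \<omega>) {..<c} (path t (copies \<omega> z))) \<le> r} \<le> \<eta>"
proof -
  define hit where "hit z \<longleftrightarrow> (\<exists>q\<in>set (path t (copies \<omega> z)). cell_address q = Some z)" for z
  define revs where "revs z = revealed (differing \<omega>) {..<c} (path t (copies \<omega> z))" for z
  define D where "D = nat \<lfloor>T\<rfloor>"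
  define K where "K = {z\<in>Pow {..<c}. hit z \<and> card (revs z) \<le> r}"
  have D: "cost t x \<le> D" for x using cost[of x] by (simp add: D_def le_nat_floor)
  have fin: "finite (Pow {..<c})" by simp
  have "real (card K) * (1 / 2) ^ r = (\<Sum>z\<in>K. (1 / 2) ^ r)" by simp
  also have "\<dots> \<le> (\<Sum>z\<in>K. (1 / 2) ^ card (revs z))"
    by (intro sum_mono power_decreasing) (auto simp: K_def)
  also have "\<dots> = (\<Sum>z\<in>K. if hit z then (1 / 2) ^ card (revs z) else 0)"
    by (intro sum.cong) (auto simp: K_def)
  also have "\<dots> \<le> (\<Sum>z\<in>Pow {..<c}. if hit z then (1 / 2) ^ card (revs z) else 0)"
    by (intro sum_mono2) (auto simp: K_def)
  also have "\<dots> \<le> real D"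
  proof -
    have X: "copies \<omega> z q = copies \<omega> z' q"
      if "\<And>i. differing \<omega> q = Some i \<Longrightarrow> i \<in> z \<longleftrightarrow> i \<in> z'" for q z z'
    proof (cases q)
      case (Inl p)
      obtain i k where p: "p = (i, k)" by force
      show ?thesis
      proof (cases "fst (\<omega> i) k = snd (\<omega> i) k")
        case False
        then have "i \<in> z \<longleftrightarrow> i \<in> z'" by (intro that) (simp add: Inl p differing_def)
        then show ?thesis by (simp add: Inl p copies_def)
      qed (simp add: Inl p copies_def)
    qed (simp add: copies_def)
    have ca: "cell_address q = None" if "differing \<omega> q = Some i" for q i
      using that by (simp add: cell_address_def differing_def split: sum.splits)
    have "(\<Sum>z | z \<subseteq> {..<c} \<and> z \<inter> {} = {} \<inter> {}.
        if \<exists>q\<in>set (path t (copies \<omega> z)). cell_address q = Some z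
        then (1 / 2 :: real) ^ card ({} \<union> revealed (differing \<omega>) {..<c} (path t (copies \<omega> z)))
        else 0) \<le> real D * (1 / 2) ^ card ({} :: nat set)"
    proof (rule sum_hit_weight_le)
      fix q z z' assume "\<And>i. differing \<omega> q = Some i \<Longrightarrow> i \<in> z \<longleftrightarrow> i \<in> z'"
      then show "copies \<omega> z q = copies \<omega> z' q" by (rule X)
    next
      fix q i assume "differing \<omega> q = Some i"
      then show "cell_address q = None" by (rule ca)
    qed (simp_all add: D)
    then show ?thesis by (simp add: hit_def revs_def Pow_def cong: if_cong)
  qed
  also have "\<dots> \<le> T" using T(2) by (simp add: D_def)
  also have "\<dots> \<le> \<eta> * 2 ^ r" by (rule T)
  finally have "real (card K) \<le> \<eta> * 2 ^ r * 2 ^ r"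
    by (simp add: power_one_over field_simps)
  also have "\<dots> = \<eta> * 2 ^ c" by (simp add: c power_mult_distrib mult_2 power_add)
  finally have "real (card K) / 2 ^ c \<le> \<eta>" by (simp add: pos_divide_le_eq)
  moreover have "K = Pow {..<c} \<inter> {z. hit z \<and> card (revs z) \<le> r}" by (auto simp: K_def)
  ultimately show ?thesis
    by (simp add: measure_pmf_of_set card_Pow hit_def revs_def Pow_not_empty)
qed

text \<open>Revealing bit \<open>i\<close> means querying a difference of the pair in copy
  \<open>i\<close>, that is, separating a hard pair after the other copies are fixed.\<close>

lemma prob_revealed_le:
  fixes p :: "(('i \<Rightarrow> bool) \<times> ('i \<Rightarrow> bool)) pmf"
  assumes i: "i < c" and \<eta>: "\<eta> \<ge> 0" and T: "T \<ge> 0"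
    and le: "\<And>t. (\<forall>x. real (cost t x) \<le> T) \<Longrightarrow>
      measure_pmf.prob p {(x, y). separates t x y} \<le> \<eta>"
    and cost: "\<And>x. real (cost t x) \<le> T"
  shows "measure_pmf.prob (Pi_pmf {..<c} d (\<lambda>_. p))
    {\<omega>. i \<in> revealed (differing \<omega>) {..<c} (path t (copies \<omega> z))} \<le> \<eta>"
proof (rule prob_Pi_pmf_le)
  fix \<omega>
  define m where "m = nat \<lfloor>T\<rfloor>"
  define s where "s = project (copy_of i) (copies \<omega> z) t m"
  have cost_s: "\<forall>x. real (cost s x) \<le> T"
    unfolding s_def m_def using T
    by (auto intro: order_trans[OF of_nat_mono[OF cost_project_le]])
  have "separates s (fst w) (snd w)"
    if "fun_upd \<omega> i w \<in> {\<omega>. i \<in> revealed (differing \<omega>) {..<c} (path t (copies \<omega> z))}" for w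
  proof -
    let ?v = "if i \<in> z then snd w else fst w" and ?v' = "if i \<in> z then fst w else snd w"
    have plug: "copies (fun_upd \<omega> i w) z = plug (copy_of i) (copies \<omega> z) ?v"
      using i by (auto simp: fun_eq_iff plug_def copy_of_def copies_def split: sum.splits)
    have "i \<in> revealed (differing (fun_upd \<omega> i w)) {..<c} (path t (copies (fun_upd \<omega> i w) z))"
      using that by (rule CollectD)
    then obtain q where q: "q \<in> set (path t (copies (fun_upd \<omega> i w) z))"
      "differing (fun_upd \<omega> i w) q = Some i"
      unfolding revealed_def by blast
    obtain k where k: "q = Inl (i, k)" "fst w k \<noteq> snd w k"
      using q(2) by (auto simp: differing_def split: sum.splits if_splits)
    \<comment> \<open>The truncation at \<open>m\<close> never takes effect: the copy cannot receive
      more queries than the whole tree makes.\<close>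
    have "length (List.map_filter (copy_of i) (path t (plug (copy_of i) (copies \<omega> z) ?v))) \<le> m"
      using length_map_filter_le[of "copy_of i" "path t (plug (copy_of i) (copies \<omega> z) ?v)"]
        cost[of "plug (copy_of i) (copies \<omega> z) ?v"]
      unfolding cost_eq_length_path m_def by (meson le_nat_floor order_trans)
    then have "separates s ?v ?v'"
      unfolding s_def using q(1) k by (intro separates_projectI[of _ _ _ _ _ q k])
        (auto simp: plug copy_of_def)
    then show ?thesis by (auto split: if_splits simp: separates_sym)
  qed
  then have "measure_pmf.prob p
      {w. fun_upd \<omega> i w \<in> {\<omega>. i \<in> revealed (differing \<omega>) {..<c} (path t (copies \<omega> z))}}
      \<le> measure_pmf.prob p {(x, y). separates s x y}"
    by (intro prob_mono_support) auto
  also have "\<dots> \<le> \<eta>" by (rule le[OF cost_s])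
  finally show "measure_pmf.prob p
      {w. fun_upd \<omega> i w \<in> {\<omega>. i \<in> revealed (differing \<omega>) {..<c} (path t (copies \<omega> z))}}
      \<le> \<eta>" .
qed (use i \<eta> in auto)

text \<open>Separation requires a query to the cell at the hidden address. Doing so with at most
  \<open>r\<close> bits revealed has probability at most \<eta>; revealing more than
  \<open>r\<close> of the \<open>2 * r\<close> bits has probability at most
  \<open>2 * \<eta>\<close> by Markov. The query bound \<open>T\<close> is not reduced.\<close>

lemma hard_cheat_sheet:
  assumes "hard f T \<eta>" and T: "T \<ge> 0" "T \<le> \<eta> * 2 ^ r" and \<eta>: "\<eta> \<ge> 0"
    and c: "c = 2 * r" "r > 0"
    and certs: "cert False True f I w" "cert False False f I w"
  shows "hard (cheat_sheet f) T (3 * \<eta>)"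
proof -
  obtain p where p: "\<And>x y. (x, y) \<in> set_pmf p \<Longrightarrow> \<not> f x \<and> f y"
    and le: "\<And>t. (\<forall>x. real (cost t x) \<le> T) \<Longrightarrow>
               measure_pmf.prob p {(x, y). separates t x y} \<le> \<eta>"
    using assms(1) unfolding hard_def by blast
  define d :: "('i \<Rightarrow> bool) \<times> ('i \<Rightarrow> bool)" where "d = undefined"
  define P where "P = pair_pmf (Pi_pmf {..<c} d (\<lambda>_. p)) (pmf_of_set (Pow {..<c}))"
  define Y where "Y x = fill f (SOME B. cheat_sheet f (fill f B x)) x" for x
  have Y: "cheat_sheet f (Y x)" for x
    unfolding Y_def by (rule someI_ex) (rule ex_cheat_sheet_fill[OF certs])
  define Q where "Q = map_pmf (\<lambda>(\<omega>, z). (copies \<omega> z, Y (copies \<omega> z))) P"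
  have vals: "\<forall>(x, y)\<in>set_pmf Q. \<not> cheat_sheet f x \<and> cheat_sheet f y"
    unfolding Q_def using Y cheat_sheet_copies by auto
  have addr: "address f (copies \<omega> z) = z" if "(\<omega>, z) \<in> set_pmf P" for \<omega> z
  proof -
    have z: "z \<subseteq> {..<c}" using that by (auto simp: P_def set_pmf_of_set Pow_not_empty)
    have "\<not> f (fst (\<omega> i)) \<and> f (snd (\<omega> i))" if "i < c" for i
      using p[of "fst (\<omega> i)" "snd (\<omega> i)"] \<open>(\<omega>, z) \<in> set_pmf P\<close> that
      by (auto simp: P_def set_Pi_pmf PiE_dflt_def)
    then have "f (\<lambda>k. copies \<omega> z (Inl (i, k))) \<longleftrightarrow> i \<in> z" if "i < c" for i
      using that by (cases "i \<in> z") (simp_all add: copies_def)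
    then show ?thesis using z by (auto simp: address_def)
  qed
  have "measure_pmf.prob Q {(x, y). separates t x y} \<le> 3 * \<eta>"
    if ct: "\<forall>x. real (cost t x) \<le> T" for t
  proof -
    define R where "R w = revealed (differing (fst w)) {..<c} (path t (copies (fst w) (snd w)))"
      for w
    define B1 where "B1 = {w. (\<exists>q\<in>set (path t (copies (fst w) (snd w))).
      cell_address q = Some (snd w)) \<and> card (R w) \<le> r}"
    define B2 where "B2 = {w. r < card (R w)}"
    have "real r * measure_pmf.prob P B2 \<le> real (card {..<c}) * \<eta>"
      unfolding B2_def
    proof (rule prob_card_gt_le)
      fix i assume "i \<in> {..<c}"
      then have i: "i < c" by simp
      show "measure_pmf.prob P {w. i \<in> R w} \<le> \<eta>"
        unfolding P_def
      proof (rule prob_pair_pmf_le_snd)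
        fix z
        show "measure_pmf.prob (Pi_pmf {..<c} d (\<lambda>_. p)) {\<omega>. (\<omega>, z) \<in> {w. i \<in> R w}} \<le> \<eta>"
          using prob_revealed_le[OF i \<eta> T(1) le, of t d z] ct by (simp add: R_def)
      qed (fact \<eta>)
    qed (auto simp: R_def revealed_def)
    then have B2: "measure_pmf.prob P B2 \<le> 2 * \<eta>"
      using c by (simp add: mult.assoc mult.left_commute)
    have "measure_pmf.prob Q {(x, y). separates t x y}
        = measure_pmf.prob P {w. separates t (copies (fst w) (snd w)) (Y (copies (fst w) (snd w)))}"
      unfolding Q_def by (simp add: vimage_def case_prod_unfold)
    also have "\<dots> \<le> measure_pmf.prob P (B1 \<union> B2)"
    proof (rule prob_mono_support)
      fix w assume w: "w \<in> set_pmf P"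
        "w \<in> {w. separates t (copies (fst w) (snd w)) (Y (copies (fst w) (snd w)))}"
      obtain q where q: "q \<in> set (path t (copies (fst w) (snd w)))"
        "copies (fst w) (snd w) q \<noteq> Y (copies (fst w) (snd w)) q"
        using w(2) by (auto simp: separates_def)
      have "cell_address q = Some (snd w)"
        using q(2) addr[of "fst w" "snd w"] w(1)
        by (auto simp: Y_def fill_def cell_address_def split: sum.splits prod.splits if_splits)
      then show "w \<in> B1 \<union> B2" using q(1) by (auto simp: B1_def B2_def)
    qed
    also have "\<dots> \<le> measure_pmf.prob P B1 + measure_pmf.prob P B2"
      by (rule measure_Un_le) auto
    also have "measure_pmf.prob P B1 \<le> \<eta>"
      unfolding P_def
    proof (rule prob_pair_pmf_le_fst)
      fix \<omega>
      show "measure_pmf.prob (pmf_of_set (Pow {..<c})) {z. (\<omega>, z) \<in> B1} \<le> \<eta>"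
        using prob_hit_le[of r t T \<eta> \<omega>] ct T c by (simp add: B1_def R_def)
    qed (fact \<eta>)
    also note B2
    finally show ?thesis by simp
  qed
  with vals show ?thesis unfolding hard_def by (intro exI[of _ Q]) auto
qed

end

subsection \<open>The iterated construction\<close>

text \<open>Only unambiguous certificates for the value 0 may have size \<^term>\<open>n * v\<close>. Composing with OR and
  AND of arity \<^term>\<open>n\<close> multiplies each of these bounds by a constant times \<^term>\<open>n\<close>, except that the
  unambiguous bound for 1 becomes quadratic in \<^term>\<open>n\<close>; the cheat sheet brings it down again.\<close>

definition stage :: "nat \<Rightarrow> nat \<Rightarrow> nat \<Rightarrow> real \<Rightarrow> real \<Rightarrow> ((nat \<Rightarrow> bool) \<Rightarrow> bool) \<Rightarrow> bool" where
  "stage N v n T \<eta> f \<longleftrightarrow> cert True True f {..<N} v \<and> cert True False f {..<N} (n * v) \<and>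
     cert False False f {..<N} v \<and> hard f T \<eta>"

lemma stage_variable: "n > 0 \<Longrightarrow> \<eta> \<ge> 0 \<Longrightarrow> stage 1 1 n (1 / 2) \<eta> (\<lambda>x. x 0)"
  using cert_variable[of _ _ "0 :: nat"]
  by (auto simp: stage_def lessThan_Suc intro: hard_variable cert_mono[OF cert_variable])

lemma cert_and:
  assumes "cert True True g I v" "cert True False g I v'"
  shows "cert True True (any_block False n g) ({..<n} \<times> I) (n * v)"
    "cert True False (any_block False n g) ({..<n} \<times> I) (v' + n * v)"
  using cert_any_block_all[of True False g I v n] cert_any_block_first[of False g I v' v n] assms
  by simp_all

text \<open>The error grows by 2 for each gate and by 3 for the cheat sheet. The second gate already
  works with error \<open>2 * \<eta>\<close>, whence the factor \<open>2 * \<eta>\<^sup>2\<close> in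
  the query bound.\<close>

lemma stage_step:
  assumes st: "stage N v n T \<eta> f" and n: "n > 0" and v: "v > 0" and r: "r > 0"
    and l: "n * n * N + 1 \<le> 2 ^ l" and T: "T \<ge> 0" and \<eta>: "\<eta> \<ge> 0"
    and le: "2 * \<eta>\<^sup>2 * (real n)\<^sup>2 * T \<le> 4 * \<eta> * 2 ^ r"
  shows "\<exists>N' f'. stage N' (2 * r * (l + 5) * n * v) n (2 * \<eta>\<^sup>2 * (real n)\<^sup>2 * T) (12 * \<eta>) f' \<and>
    N' \<le> 2 * r * (n * n * N) + 2 ^ (2 * r) * (l * (n * v) * (2 * r) + 1)"
proof -
  define w where "w = n * v"
  define c where "c = 2 * r"
  \<comment> \<open>\<open>l\<close> bits name a variable of \<open>h\<close> or a blank, for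
    \<open>w\<close> positions in each of \<open>c\<close> copies; the extra bit makes room for the
    invalid empty cell.\<close>
  define L where "L = l * w * c + 1"
  define I where "I = {..<n} \<times> ({..<n} \<times> {..<N})"
  define a where "a = any_block False n f"
  define h where "h = any_block True n a"
  have f1: "cert True True f {..<N} v" and f0: "cert True False f {..<N} (n * v)"
    and f0': "cert False False f {..<N} v" and hf: "hard f T \<eta>"
    using st by (auto simp: stage_def)
  have a1: "cert True True a ({..<n} \<times> {..<N}) w"
    and a0: "cert True False a ({..<n} \<times> {..<N}) (w + w)"
    unfolding a_def w_def using cert_and[OF f1 f0, of n] by simp_all
  have a0': "cert False False a ({..<n} \<times> {..<N}) v"
    unfolding a_def by (rule cert_any_block_some[OF f0'])
  have ha: "hard a (\<eta> * n * T) (2 * \<eta>)"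
    unfolding a_def by (rule hard_any_block[OF hf T \<eta> n])
  have h0: "cert True False h I (n * (w + w))"
    unfolding h_def I_def using cert_any_block_all[of True True a _ "w + w" n] a0 by simp
  have h1: "cert True True h I (w + n * (w + w))"
    unfolding h_def I_def using cert_any_block_first[of True a _ w "w + w" n] a0 a1 by simp
  have h0': "cert False False h I w"
    unfolding h_def I_def w_def using cert_any_block_all[of False True a _ v n] a0' by simp
  have h1': "cert False True h I w"
    unfolding h_def I_def using a1 by (intro cert_any_block_some) (rule cert_mono, auto)
  have "hard h ((2 * \<eta>) * n * (\<eta> * n * T)) (2 * (2 * \<eta>))"
    unfolding h_def by (rule hard_any_block[OF ha]) (use T \<eta> n in auto)
  then have hh: "hard h (2 * \<eta>\<^sup>2 * (real n)\<^sup>2 * T) (4 * \<eta>)"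
    by (simp add: power2_eq_square mult_ac)
  have finI: "finite I" and cardI: "card I = n * n * N"
    by (auto simp: I_def card_cartesian_product)
  have "((card I + 1) ^ w) ^ c \<le> ((2 ^ l) ^ w) ^ c"
    using l by (intro power_mono) (auto simp: cardI)
  also have "\<dots> = (2 :: nat) ^ (l * w * c)" by (simp add: power_mult)
  also have "\<dots> < 2 ^ L" unfolding L_def by (intro power_strict_increasing) auto
  finally obtain dec where dec: "cell_code I c w L dec"
    using ex_cell_code[OF finI, of w c L] by blast
  interpret cell_code I c w L dec by (rule dec)
  define g where "g = cheat_sheet h"
  have cw: "0 < c * w" using r n v by (simp add: c_def w_def)
  define V where "V = 2 * r * (l + 5) * n * v"
  \<comment> \<open>In \<open>l + 5\<close>, the part \<open>l + 2\<close> covers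
    \<open>L + c * w\<close>, and 3 comes from the unambiguous certificates of \<open>h\<close>, of
    size at most \<open>3 * n * w\<close> each.\<close>
  have V: "V = c * w * (l + 5)" by (simp add: V_def c_def w_def mult_ac)
  have g1: "cert True True g variables V"
    unfolding g_def
    by (rule cert_mono[OF cert_cheat_sheet_True])
       (use cw in \<open>auto simp: V L_def algebra_simps\<close>)
  have g0': "cert False False g variables V"
    unfolding g_def
    by (rule cert_mono[OF cert_cheat_sheet[OF h1' h0']])
       (use cw in \<open>auto simp: V L_def algebra_simps\<close>)
  have g0: "cert True False g variables (n * V)"
    unfolding g_def
  proof (rule cert_mono[OF cert_cheat_sheet])
    show "cert True True h I (3 * n * w)" "cert True False h I (3 * n * w)"
      using n by (auto intro!: cert_mono[OF h1] cert_mono[OF h0] simp: algebra_simps)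
    have "L + c * w \<le> c * w * (l + 2)" using cw by (simp add: L_def algebra_simps)
    also have "\<dots> \<le> n * (c * w * (l + 2))" using n by simp
    finally show "L + c * w + c * (3 * n * w) \<le> n * V" by (simp add: V algebra_simps)
  qed auto
  have hg: "hard g (2 * \<eta>\<^sup>2 * (real n)\<^sup>2 * T) (3 * (4 * \<eta>))"
    unfolding g_def
    by (rule hard_cheat_sheet[OF hh _ le]) (use T \<eta> r c_def h1' h0' in auto)
  obtain e :: "_ \<Rightarrow> nat" and e' where e: "e ` variables = {..<card variables}"
    "\<And>i. i \<in> variables \<Longrightarrow> e' (e i) = i"
    using ex_renaming[OF finite_variables[OF finI]] by blast
  let ?g = "\<lambda>z. g (\<lambda>i. z (e i))"
  have "stage (card variables) V n (2 * \<eta>\<^sup>2 * (real n)\<^sup>2 * T) (12 * \<eta>) ?g"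
    unfolding stage_def
  proof (intro conjI)
    show "cert True True ?g {..<card variables} V" "cert True False ?g {..<card variables} (n * V)"
      "cert False False ?g {..<card variables} V"
      using cert_reindex[where h = e and h' = e', OF g1 e(2)] cert_reindex[where h = e and h' = e', OF g0 e(2)] cert_reindex[where h = e and h' = e', OF g0' e(2)]
      by (simp_all add: e(1))
    have dep: "g x = g y" if "\<And>i. i \<in> variables \<Longrightarrow> x i = y i" for x y
      by (rule cert_depends[OF g1]) (use g0 that in auto)
    show "hard ?g (2 * \<eta>\<^sup>2 * (real n)\<^sup>2 * T) (12 * \<eta>)"
      using hard_reindex[where h = e and h' = e', OF hg e(2) dep] by simp
  qed
  moreover have "card variables \<le> 2 * r * (n * n * N) + 2 ^ (2 * r) * (l * (n * v) * (2 * r) + 1)"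
    using card_variables_le[OF finI] by (simp add: cardI c_def L_def w_def)
  ultimately show ?thesis unfolding V_def by blast
qed

text \<open>UC_0 of \<open>f\<close> is already bounded by \<open>n * v\<close>, so AND_n brings
  both sides to order \<open>n * v\<close>. Its error 2/8 is below 1/3, and its 1-inputs need
  \<open>n\<close> positions, which drives UC to infinity.\<close>

lemma final_function:
  assumes st: "stage N v n T (1 / 8) f" and n: "n > 0" and T: "T \<ge> 0"
  shows "\<exists>M F. n \<le> UC {..<M} F \<and> UC {..<M} F \<le> 2 * n * v \<and>
    n * T / 8 \<le> randomized_query_complexity {..<M :: nat} F"
proof -
  define I where "I = {..<n} \<times> {..<N}"
  define a where "a = any_block False n f"
  have f1: "cert True True f {..<N} v" and f0: "cert True False f {..<N} (n * v)"
    and hf: "hard f T (1 / 8)"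
    using st by (auto simp: stage_def)
  have a1: "cert True True a I (n * v)" and a0: "cert True False a I (n * v + n * v)"
    unfolding a_def I_def by (rule cert_and[OF f1 f0])+
  have dep: "a x = a y" if "\<And>i. i \<in> I \<Longrightarrow> x i = y i" for x y
    by (rule cert_depends[OF a1]) (use a0 that in auto)
  have ha: "hard a (1 / 8 * n * T) (2 * (1 / 8))"
    unfolding a_def by (rule hard_any_block[OF hf T _ n]) simp
  \<comment> \<open>The hard pairs show that \<open>f\<close> is not constant, as the lower bound on
    certificates requires.\<close>
  obtain p where "\<forall>(x, y)\<in>set_pmf p. \<not> f x \<and> f y"
    using hf unfolding hard_def by blast
  moreover obtain xy where "xy \<in> set_pmf p" using set_pmf_not_empty[of p] by blast
  ultimately have xy: "\<not> f (fst xy)" "f (snd xy)" by auto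
  have na: "needs True a n"
    unfolding a_def using needs_any_block[of f "snd xy" False "fst xy" n] xy by simp
  have finI: "finite I" by (simp add: I_def)
  obtain e :: "_ \<Rightarrow> nat" and e' where e: "e ` I = {..<card I}"
    "\<And>i. i \<in> I \<Longrightarrow> e' (e i) = i"
    using ex_renaming[OF finI] by blast
  let ?F = "\<lambda>z. a (\<lambda>i. z (e i))"
  let ?J = "{..<card I}"
  have F1: "cert True True ?F ?J (n * v)" and F0: "cert True False ?F ?J (n * v + n * v)"
    using cert_reindex[where h = e and h' = e', OF a1 e(2)] cert_reindex[where h = e and h' = e', OF a0 e(2)] by (simp_all add: e(1))
  have depF: "?F x = ?F y" if "\<And>i. i \<in> ?J \<Longrightarrow> x i = y i" for x y
    by (rule dep, rule that) (use e(1) in auto)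
  have "UC_val True ?J ?F \<le> n * v" "UC_val False ?J ?F \<le> n * v + n * v"
    by (rule UC_val_le[OF F1], rule UC_val_le[OF F0])
  then have "UC ?J ?F \<le> 2 * n * v" by (simp add: UC_def)
  moreover have "n \<le> UC_val True ?J ?F"
    by (rule UC_val_ge[where f = ?F, OF F1 _ needs_reindex[where h = e and h' = e', OF na e(2) dep] depF]) auto
  then have "n \<le> UC ?J ?F" by (simp add: UC_def)
  moreover have "1 / 8 * n * T \<le> randomized_query_complexity ?J ?F"
    by (rule randomized_query_complexity_ge[where f = ?F, OF _ depF hard_reindex[where h = e and h' = e', OF ha e(2) dep]]) auto
  then have "n * T / 8 \<le> randomized_query_complexity ?J ?F" by simp
  ultimately show ?thesis by blast
qed

text \<open>\<open>A\<close> may depend on \<open>k\<close> and \<eta> but not on \<open>m\<close>,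
  the logarithm of the arity. The bound on \<open>N\<close> keeps the name of a variable at O(m)
  bits, and the upper bound on \<open>T\<close> limits the number of copies required.\<close>

definition attains :: "nat \<Rightarrow> real \<Rightarrow> nat \<Rightarrow> nat \<Rightarrow> bool" where
  "attains k \<eta> A m \<longleftrightarrow> (\<exists>N v f. \<exists>T :: real. stage N v (2 ^ m) T \<eta> f \<and>
     0 < v \<and> v \<le> A * m ^ A * 2 ^ (m * k) \<and> N \<le> 2 ^ (A * m) \<and>
     T \<ge> 0 \<and> T \<le> 2 ^ (2 * m * k) \<and> 2 ^ (2 * m * k) \<le> A * T)"

text \<open>The error is universally quantified because a step multiplies it by 12: the induction
  hypothesis is used at \<open>\<eta> / 12\<close>.\<close>

lemma stages: "0 < \<eta> \<Longrightarrow> \<eta> \<le> 1 \<Longrightarrow> \<exists>A. \<forall>m>0. attains k \<eta> A m"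
proof (induction k arbitrary: \<eta>)
  case 0
  have "stage 1 1 (2 ^ m) (1 / 2) \<eta> (\<lambda>x. x 0) \<and> 0 < (1 :: nat) \<and>
      1 \<le> 2 * m ^ 2 * 2 ^ (m * 0) \<and> 1 \<le> (2 :: nat) ^ (2 * m) \<and> 0 \<le> (1 / 2 :: real) \<and>
      1 / 2 \<le> (2 :: real) ^ (2 * m * 0) \<and> 2 ^ (2 * m * 0) \<le> real 2 * (1 / 2)"
    if "m > 0" for m :: nat
    using that 0 stage_variable[of "2 ^ m" \<eta>] by (simp add: Suc_le_eq)
  then show ?case unfolding attains_def by blast
next
  case (Suc k)
  obtain A where A: "\<forall>m>0. attains k (\<eta> / 12) A m"
  proof -
    have "0 < \<eta> / 12" "\<eta> / 12 \<le> 1" using Suc.prems by auto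
    from Suc.IH[OF this] show ?thesis using that by (elim exE)
  qed
  \<comment> \<open>\<open>B\<close> adds up separate demands: the coefficient and the exponent in
    the bound on \<open>v'\<close>, the number of variables in the copies (\<open>e1\<close>) and in
    the cells (\<open>e2\<close>), and the loss \<open>\<eta>\<^sup>2 / 72\<close> in the query
    bound (\<open>a\<close>).\<close>
  define a where "a = nat \<lceil>72 * A / \<eta>\<^sup>2\<rceil>"
  define e1 where "e1 = 4 * Suc k + 2 + A"
  define e2 where "e2 = 4 * Suc k + ((2 + A + 1) + (1 + (2 * A + k)) + 4 * Suc k + 1)"
  define B where "B = 4 * Suc k * (A + 8) * A + (A + 2) + (e1 + e2 + 1) + a"
  have "attains (Suc k) \<eta> B m"
    if m: "m > 0" for m
  proof -
    obtain N v f and T :: real where st: "stage N v (2 ^ m) T (\<eta> / 12) f" and v: "0 < v"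
      and v_le: "v \<le> A * m ^ A * 2 ^ (m * k)" and N_le: "N \<le> 2 ^ (A * m)"
      and T: "T \<ge> 0" "T \<le> 2 ^ (2 * m * k)" "2 ^ (2 * m * k) \<le> A * T"
      using A[rule_format, OF m] unfolding attains_def by blast
    \<comment> \<open>Then \<open>2 ^ r\<close> is n^(2(k+1)), the scale of the new query bound, as
      guessing an address requires.\<close>
    define r where "r = 2 * m * Suc k"
    define l where "l = 2 * m + A * m + 1"
    define n :: nat where "n = 2 ^ m"
    define T' where "T' = 2 * (\<eta> / 12)\<^sup>2 * (real n)\<^sup>2 * T"
    define v' where "v' = 2 * r * (l + 5) * n * v"
    have n2: "n * n = 2 ^ (2 * m)" by (simp add: n_def mult_2 power_add)
    have n2r: "(real n)\<^sup>2 = 2 ^ (2 * m)"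
      by (simp add: n_def power2_eq_square mult_2 power_add)
    have T'_eq: "T' = \<eta>\<^sup>2 / 72 * (2 ^ (2 * m) * T)"
      unfolding T'_def n2r by (simp add: power2_eq_square)
    have \<eta>2: "0 < \<eta>\<^sup>2" "\<eta>\<^sup>2 \<le> \<eta>" using Suc.prems
      using mult_left_le[of \<eta> \<eta>] by (simp_all add: power2_eq_square)
    have "2 ^ (2 * m) * T \<le> 2 ^ (2 * m) * 2 ^ (2 * m * k)" using T by (intro mult_left_mono) auto
    also have "\<dots> = 2 ^ r" by (simp add: r_def algebra_simps power_add)
    finally have T_le: "2 ^ (2 * m) * T \<le> 2 ^ r" .
    have T'_le: "T' \<le> \<eta> / 72 * 2 ^ r"
      unfolding T'_eq using \<eta>2 T T_le Suc.prems by (intro mult_mono) auto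
    have "\<eta> / 72 * 2 ^ r \<le> 1 * 2 ^ r" using Suc.prems by (intro mult_right_mono) auto
    with T'_le have "T' \<le> 1 * 2 ^ r" by (rule order_trans)
    then have T'_le2: "T' \<le> 2 ^ (2 * m * Suc k)" by (simp only: r_def mult_1)
    have "\<exists>N' f'. stage N' v' n T' (12 * (\<eta> / 12)) f' \<and>
      N' \<le> 2 * r * (n * n * N) + 2 ^ (2 * r) * (l * (n * v) * (2 * r) + 1)"
      unfolding T'_def v'_def
    proof (rule stage_step)
      show "stage N v n T (\<eta> / 12) f" using st by (simp add: n_def)
      have "n * n * N + 1 \<le> 2 ^ (2 * m) * 2 ^ (A * m) + 2 ^ (2 * m + A * m)"
        using N_le by (intro add_mono mult_mono) (auto simp: n2)
      also have "\<dots> = 2 ^ l" by (simp add: l_def power_add)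
      finally show "n * n * N + 1 \<le> 2 ^ l" .
      have "\<eta> / 72 * 2 ^ r \<le> 4 * (\<eta> / 12) * 2 ^ r"
        using Suc.prems by (intro mult_right_mono) auto
      with T'_le show "2 * (\<eta> / 12)\<^sup>2 * (real n)\<^sup>2 * T \<le> 4 * (\<eta> / 12) * 2 ^ r"
        unfolding T'_def by (rule order_trans)
    qed (use v m T Suc.prems in \<open>auto simp: n_def r_def\<close>)
    then obtain N' f' where st': "stage N' v' n T' \<eta> f'"
      and N': "N' \<le> 2 * r * (n * n * N) + 2 ^ (2 * r) * (l * (n * v) * (2 * r) + 1)"
      using Suc.prems by (elim exE conjE) simp
    have v': "v' \<le> B * m ^ B * 2 ^ (m * Suc k)"
    proof -
      have "l + 5 \<le> (A + 8) * m" using m by (simp add: l_def algebra_simps)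
      moreover have r2: "2 * r = 4 * m * Suc k" by (simp add: r_def)
      ultimately have "v' \<le> (4 * m * Suc k) * ((A + 8) * m) * 2 ^ m * (A * m ^ A * 2 ^ (m * k))"
        unfolding v'_def n_def r2 using v_le by (intro mult_le_mono order_refl) simp_all
      also have "\<dots> = (4 * Suc k * (A + 8) * A) * m ^ (A + 2) * 2 ^ (m * Suc k)"
        by (simp add: power_add power2_eq_square mult_ac)
      also have "\<dots> \<le> B * m ^ B * 2 ^ (m * Suc k)"
        using m by (intro mult_mono power_increasing) (auto simp: B_def)
      finally show ?thesis .
    qed
    have N'_le: "N' \<le> 2 ^ (B * m)"
    proof -
      have less: "x \<le> 2 ^ x" for x :: nat using less_exp[of x] by simp
      have r2: "2 * r = 4 * Suc k * m" by (simp add: r_def algebra_simps)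
      have "2 * r * (n * n * N) \<le> 2 ^ (4 * Suc k * m) * (2 ^ (2 * m) * 2 ^ (A * m))"
        unfolding n2 using less[of "2 * r"] N_le by (intro mult_mono) (auto simp: r2)
      also have "\<dots> = 2 ^ (e1 * m)"
        unfolding power_add[symmetric]
        by (rule arg_cong[where f = "power 2"]) (simp add: e1_def algebra_simps)
      finally have 1: "2 * r * (n * n * N) \<le> 2 ^ (e1 * m)" .
      have "A \<le> A * m" using m by simp
      also have "\<dots> \<le> 2 ^ (A * m)" by (rule less)
      finally have A_le: "A \<le> 2 ^ (A * m)" .
      have "m ^ A \<le> (2 ^ m) ^ A" by (intro power_mono less) simp
      also have "\<dots> = 2 ^ (A * m)" by (simp only: power_mult[symmetric] mult.commute)
      finally have "A * m ^ A * 2 ^ (m * k) \<le> 2 ^ (A * m) * 2 ^ (A * m) * 2 ^ (m * k)"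
        using A_le by (intro mult_le_mono order_refl)
      also have "\<dots> = 2 ^ ((2 * A + k) * m)"
        unfolding power_add[symmetric] by (rule arg_cong[where f = "power 2"]) (simp add: algebra_simps)
      finally have v_le': "v \<le> 2 ^ ((2 * A + k) * m)" using v_le by (rule order_trans[rotated])
      have "l \<le> (2 + A + 1) * m" using m by (simp add: l_def algebra_simps)
      then have l_le: "l \<le> 2 ^ ((2 + A + 1) * m)"
        using less[of "(2 + A + 1) * m"] by (rule order_trans)
      define e where "e = ((2 + A + 1) + (1 + (2 * A + k)) + 4 * Suc k) * m"
      have "l * (n * v) * (2 * r)
          \<le> 2 ^ ((2 + A + 1) * m) * (2 ^ m * 2 ^ ((2 * A + k) * m)) * 2 ^ (2 * r)"
        unfolding n_def by (rule mult_le_mono[OF mult_le_mono[OF l_le mult_le_mono[OF order_refl v_le']] less])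
      also have "\<dots> = 2 ^ e"
        unfolding r2 power_add[symmetric]
        by (rule arg_cong[where f = "power 2"]) (simp add: e_def algebra_simps)
      finally have "l * (n * v) * (2 * r) + 1 \<le> 2 ^ e + 2 ^ e"
        by (rule add_le_mono) simp
      also have "\<dots> = 2 ^ Suc e" by simp
      also have "\<dots> \<le> 2 ^ (e + m)" using m by (intro power_increasing) auto
      finally have "2 ^ (2 * r) * (l * (n * v) * (2 * r) + 1) \<le> 2 ^ (4 * Suc k * m) * 2 ^ (e + m)"
        unfolding r2 by (rule mult_le_mono2)
      also have "\<dots> = 2 ^ (e2 * m)"
        unfolding power_add[symmetric]
        by (rule arg_cong[where f = "power 2"]) (simp add: e2_def e_def algebra_simps)
      finally have 2: "2 ^ (2 * r) * (l * (n * v) * (2 * r) + 1) \<le> 2 ^ (e2 * m)" .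
      have "N' \<le> 2 ^ (e1 * m) + 2 ^ (e2 * m)" using N' 1 2 by linarith
      also have "\<dots> \<le> 2 ^ ((e1 + e2) * m) + 2 ^ ((e1 + e2) * m)"
        by (intro add_mono power_increasing) auto
      also have "\<dots> = 2 ^ Suc ((e1 + e2) * m)" by simp
      also have "\<dots> \<le> 2 ^ (B * m)"
      proof (rule power_increasing)
        have "Suc ((e1 + e2) * m) \<le> (e1 + e2 + 1) * m" using m by simp
        also have "\<dots> \<le> B * m" by (rule mult_le_mono1) (simp add: B_def)
        finally show "Suc ((e1 + e2) * m) \<le> B * m" .
      qed simp
      finally show ?thesis .
    qed
    have "2 ^ (2 * m * Suc k) \<le> B * T'"
    proof -
      have "72 * A / \<eta>\<^sup>2 \<le> real a" unfolding a_def by (rule real_nat_ceiling_ge)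
      also have "\<dots> \<le> real B" by (simp add: B_def)
      finally have B: "72 * A \<le> B * \<eta>\<^sup>2" using \<eta>2 by (simp add: pos_divide_le_eq)
      have "(2 :: real) ^ (2 * m * Suc k) = 2 ^ (2 * m) * 2 ^ (2 * m * k)"
        by (simp add: algebra_simps flip: power_add)
      also have "\<dots> \<le> 2 ^ (2 * m) * (A * T)" using T by (intro mult_left_mono) auto
      also have "\<dots> = 72 * A * (2 ^ (2 * m) * T) / 72" by simp
      also have "\<dots> \<le> B * \<eta>\<^sup>2 * (2 ^ (2 * m) * T) / 72"
        using B T by (intro divide_right_mono mult_right_mono) auto
      also have "\<dots> = B * T'" by (simp add: T'_eq)
      finally show ?thesis .
    qed
    moreover have "0 < v'" using v m by (simp add: v'_def r_def n_def)
    moreover have "0 \<le> T'" using T by (simp add: T'_def)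
    ultimately show ?thesis
      using st' v' N'_le T'_le2 unfolding n_def attains_def by blast
  qed
  then show ?case by blast
qed

text \<open>For \<open>m = 2 ^ (2 * t)\<close> the logarithm of \<open>m\<close> is exact, and the
  claim becomes \<open>C + 2 * t * B \<le> 2 ^ (2 * t)\<close>.\<close>

lemma ex_poly_le_power:
  fixes B C k :: nat
  shows "\<exists>m\<ge>k. C * m ^ B \<le> 2 ^ m"
proof -
  have less: "x \<le> 2 ^ x" for x :: nat using less_exp[of x] by simp
  define t where "t = 2 * B + C + k"
  define m :: nat where "m = 2 ^ (2 * t)"
  have "C + 2 * t * B = C + t * (2 * B)" by simp
  also have "\<dots> \<le> t + t * (2 * B)" by (simp add: t_def)
  also have "\<dots> \<le> t + t * t" by (intro add_left_mono mult_left_mono) (auto simp: t_def)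
  also have "\<dots> \<le> (Suc t)\<^sup>2" by (simp add: power2_eq_square)
  also have "\<dots> \<le> (2 ^ t)\<^sup>2" using less_exp[of t] by (intro power_mono) (auto simp: Suc_le_eq)
  also have "\<dots> = m" by (simp add: m_def power_mult mult.commute)
  finally have m: "C + 2 * t * B \<le> m" .
  have "C * m ^ B \<le> 2 ^ C * m ^ B" using less[of C] by simp
  also have "\<dots> = 2 ^ (C + 2 * t * B)" by (simp add: m_def power_add power_mult)
  also have "\<dots> \<le> 2 ^ m" using m by (intro power_increasing) auto
  finally have "C * m ^ B \<le> 2 ^ m" .
  moreover have "k \<le> m"
  proof -
    have "k \<le> 2 * t" by (simp add: t_def)
    also have "\<dots> \<le> m" using less[of "2 * t"] by (simp add: m_def)
    finally show ?thesis .
  qed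
  ultimately show ?thesis by blast
qed


text \<open>The exponent is 2k/(k+1), so UC of order n^(k+1) becomes n^(2k), while the randomized
  complexity is of order n^(2k+1). The gap of one factor n = \<open>2 ^ m\<close> outgrows all
  polynomials in \<open>m\<close>.\<close>

lemma ex_separation:
  "\<exists>N f. k \<le> UC {..<N} f \<and>
    real (UC {..<N} f) powr (2 - 2 / real (Suc k)) \<le> randomized_query_complexity {..<N :: nat} f"
proof -
  obtain A where A: "\<forall>m>0. attains k (1 / 8) A m"
    using stages[of "1 / 8" k] by auto
  \<comment> \<open>The 8 comes from \<open>final_function\<close>, one \<open>A\<close> from the
    loss in \<open>T\<close>, and the rest is the square of \<open>P\<close>, the excess of UC over
    \<open>2 ^ (m * Suc k)\<close>, since the exponent is at most 2.\<close>
  obtain m where m: "m \<ge> Suc k" "8 * A * (2 * A)\<^sup>2 * m ^ (2 * A) \<le> 2 ^ m"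
    using ex_poly_le_power[of "Suc k" "8 * A * (2 * A)\<^sup>2" "2 * A"] by blast
  then have "m > 0" by simp
  obtain N v f and T :: real where st: "stage N v (2 ^ m) T (1 / 8) f"
    and v: "0 < v" "v \<le> A * m ^ A * 2 ^ (m * k)"
    and T: "T \<ge> 0" "2 ^ (2 * m * k) \<le> A * T"
    using A[rule_format, OF \<open>m > 0\<close>] unfolding attains_def by blast
  obtain M F where F: "2 ^ m \<le> UC {..<M} F" "UC {..<M} F \<le> 2 * 2 ^ m * v"
    "real (2 ^ m) * T / 8 \<le> randomized_query_complexity {..<M :: nat} F"
    using final_function[OF st _ T(1)] by auto
  define e where "e = 2 - 2 / real (Suc k)"
  define P where "P = 2 * real A * real m ^ A"
  have e: "0 \<le> e" "e \<le> 2" "real (Suc k) * e = 2 * real k"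
    by (auto simp: e_def field_simps)
  have A0: "A > 0" using v by (cases A) auto
  have P: "P \<ge> 1"
  proof -
    have "1 * 1 \<le> (2 * real A) * real m ^ A"
      using A0 \<open>m > 0\<close> by (intro mult_mono one_le_power) auto
    then show ?thesis by (simp add: P_def)
  qed
  have "real (UC {..<M} F) \<le> real (2 * 2 ^ m * (A * m ^ A * 2 ^ (m * k)))"
    unfolding of_nat_le_iff using F(2) v(2) by (meson le_trans mult_le_mono2)
  also have "\<dots> = P * 2 ^ (m * Suc k)" by (simp add: P_def power_add mult_ac)
  finally have "real (UC {..<M} F) powr e \<le> (P * 2 ^ (m * Suc k)) powr e"
    using e by (intro powr_mono2) auto
  also have "\<dots> = P powr e * (2 ^ (m * Suc k)) powr e"
    using P by (simp add: powr_mult)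
  also have "(2 ^ (m * Suc k) :: real) powr e = 2 powr (real m * (real (Suc k) * e))"
    by (simp only: powr_powr of_nat_mult mult.assoc flip: powr_realpow)
  also have "\<dots> = 2 powr real (2 * m * k)" unfolding e(3) by (simp add: mult_ac)
  also have "\<dots> = 2 ^ (2 * m * k)" by (simp only: powr_realpow)
  also have "P powr e \<le> P powr 2" using P e by (intro powr_mono) auto
  also have "P powr 2 = P\<^sup>2" using P by (simp add: powr_numeral)
  finally have "real (UC {..<M} F) powr e \<le> P\<^sup>2 * 2 ^ (2 * m * k)" by simp
  also have "\<dots> \<le> P\<^sup>2 * (A * T)" using T by (intro mult_left_mono) auto
  also have "\<dots> = (8 * A * P\<^sup>2) * T / 8" by simp
  also have "\<dots> \<le> real (2 ^ m) * T / 8"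
  proof -
    have "8 * A * P\<^sup>2 = real (8 * A * (2 * A)\<^sup>2 * m ^ (2 * A))"
      by (simp add: P_def power_mult_distrib mult.commute flip: power_mult)
    also have "\<dots> \<le> real (2 ^ m)" unfolding of_nat_le_iff by (rule m)
    finally show ?thesis using T(1) by (intro divide_right_mono mult_right_mono) auto
  qed
  also have "\<dots> \<le> randomized_query_complexity {..<M} F" by (rule F)
  finally have "real (UC {..<M} F) powr e \<le> randomized_query_complexity {..<M} F" .
  moreover have "k \<le> UC {..<M} F"
  proof -
    have "k \<le> 2 ^ m" using m(1) less_exp[of m] by linarith
    then show ?thesis using F(1) by (rule le_trans)
  qed
  ultimately show ?thesis unfolding e_def by blast
qed

theorem theorem3:
  "\<exists>(N :: nat \<Rightarrow> nat) (f :: nat \<Rightarrow> (nat \<Rightarrow> bool) \<Rightarrow> bool) (\<epsilon> :: nat \<Rightarrow> real).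
     filterlim (\<lambda>j. UC {..<N j} (f j)) at_top sequentially \<and>
     \<epsilon> \<longlonglongrightarrow> 0 \<and>
     (\<forall>j. real (randomized_query_complexity {..<N j} (f j))
            \<ge> real (UC {..<N j} (f j)) powr (2 - \<epsilon> j))"
proof -
  define good where "good k N f \<longleftrightarrow> k \<le> UC {..<N} f \<and>
    real (UC {..<N} f) powr (2 - 2 / real (Suc k)) \<le> randomized_query_complexity {..<N :: nat} f"
    for k N f
  \<comment> \<open>The depth itself serves as the index of the sequence: both the exponent and the
    lower bound on UC improve with it.\<close>
  have "\<forall>k. \<exists>N f. good k N f"
    unfolding good_def by (intro allI ex_separation)
  then obtain N where "\<forall>k. \<exists>f. good k (N k) f"
    using choice[of "\<lambda>k N. \<exists>f. good k N f"] by blast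
  then obtain f where good: "good k (N k) (f k)" for k
    using choice[of "\<lambda>k f. good k (N k) f"] by blast
  have "filterlim (\<lambda>j. UC {..<N j} (f j)) at_top sequentially"
    by (rule filterlim_at_top_mono[OF filterlim_ident]) (use good in \<open>simp add: good_def\<close>)
  moreover have "(\<lambda>j. 2 / real (Suc j)) \<longlonglongrightarrow> 0"
    using tendsto_mult_right_zero[OF LIMSEQ_inverse_real_of_nat, of 2]
    by (simp add: divide_inverse)
  ultimately show ?thesis
    using good unfolding good_def
    by (intro exI[of _ N] exI[of _ f] exI[of _ "\<lambda>j. 2 / real (Suc j)"]) blast
qed

end
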